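(* Let $(x,u)\in\mathcal S$ with mode insertion gradient $d$. If $\theta<0$, and $\overline m=1$ or $\overline m=2$, then $-d$ is a descent direction; that is, there is $\delta\gamma>0$ such that for each $\gamma\in(\gamma_0,\gamma_0+\delta\gamma)$, $J(\gamma)<J(0)$, where $J(\gamma):=J(\mathcal P(x,u-\gamma d))$.
   Context: Setting. Fix $T>0$, $x_0\in\mathbb R^n$, modes $f_1,\dots,f_N:\mathbb R^n\to\mathbb R^n$ and a running cost $\ell:\mathbb R^n\to\mathbb R$. Standing assumption: each $f_i$ and $\ell$ are $C^2$ on $\mathbb R^n$ with $\|D^2f_i(x)\|\le K_2$, $\|D^2\ell(x)\|\le\overline K_2$ for all $x$, for some constants. A switching control is a piecewise constant $u=[u_1,\dots,u_N]^T$ on $[0,T]$ with $u_i(t)\in\{0,1\}$ and $\sum_iu_i(t)=1$ for a.e. $t$. It is equivalently described by its mode schedule $(\Sigma,\mathcal T)$, $\Sigma=[\sigma_1,\dots,\sigma_M]$, $\mathcal T=[T_1<\dots<T_{M-1}]$, through $u(t)=e_{\sigma_i}$ for $t\in[T_{i-1},T_i)$, $T_0=0$, $T_M=T$ ($e_j$ is the $j$th standard basis vector); the $T_i$ are the switching times. $u$ is non-chattering if for some $\delta t>0$ all adjacent switching times differ by more than $\delta t$; $\Omega$ is the set of non-chattering switching controls. $\mathcal X$, $\mathcal U$ are the Lebesgue integrable functions from $[0,T]$ to $\mathbb R^n$, $\mathbb R^N$. With $F(x,u)=\sum_iu_if_i(x)$, $\mathcal S$ is the set of $(x,u)\in\mathcal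 X\times\mathcal U$ with $u\in\Omega$ and $\dot x=F(x,u)$, $x(0)=x_0$ (in integral form). The cost is $J(x,u)=\int_0^T\ell(x(\tau))\,d\tau$. The adjoint $\rho$ solves $\dot\rho=-D_1F(x,u)^T\rho-D\ell(x)^T$, $\rho(T)=0$. The mode insertion gradient of $J$ at $(x,u)$ is $d=[d_1,\dots,d_N]^T$, $d_a(t)=\rho(t)^T(f_a(x(t))-F(x(t),u(t)))$. Double indices denote differences: $d_{ab}=d_a-d_b$. Projection. $\mathcal Q_i(\mu(t))=\prod_{j\ne i}1(\mu_i(t)-\mu_j(t))$ with $1(s)=1$ for $s\ge0$, $1(s)=0$ for $s<0$. $\mathcal R\subset\mathcal U$ is the set of $\mu$ with $\mathcal Q(\mu)\in\Omega$. $\mathcal P(\alpha,\mu)=(x,u)$ for $(\alpha,\mu)\in\mathcal X\times\mathcal R$, where $u=\mathcal Q(\mu)$ and $x$ solves $\dot x=F(x,u)$, $x(0)=x_0$. Standing assumption: $d$ is piecewise continuous and for $i\neq j$ the function $d_i-d_j$ has finitely many critical points in $[0,T]$ (points where its derivative vanishes or it is not differentiable); this guarantees $u-\gamma d\in\mathcal R$ for $\gamma>0$. Optimality function and schedule. $\theta=\theta(x,u):=\min_{\sigma\in\{1,\dots,N\},\,t\in[0,T]}d_\sigma(t)$ (the lower bound of $d$ over modes and times), and $\gamma_0:=-1/\theta$ when $\theta<0$. $(\Sigma(\gamma),\mathcal T(\gamma))$ is the mode schedule of $\mathcal Q(u-\gamma d)$, with $\mathcal T(\gamma)=[T_1(\gamma),\dots,T_{M-1}(\gamma)]$.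 The mode sequence $\Sigma(\gamma)=[\sigma_1,\dots,\sigma_M]$ is constant for $\gamma$ in some interval $(\gamma_0,\gamma_0+\delta)$. The superscript $+$ denotes a limit from the right: $T_i(\gamma_0^+)=\lim_{\gamma\downarrow\gamma_0}T_i(\gamma)$, and values of $d$ and its time derivatives at $T_i(\gamma_0^+)$ are the limits of the values at $T_i(\gamma)$ as $\gamma\downarrow\gamma_0$. Types. $T_i(\gamma_0^+)$, between modes $\sigma_i$ and $\sigma_{i+1}$ of $\Sigma(\gamma_0^+)$, has type $m(T_i(\gamma_0^+))=0$ if $T_i(\gamma)$ is constant for $\gamma\in(\gamma_0,\gamma_0+\delta\gamma)$ for some $\delta\gamma>0$; otherwise $m(T_i(\gamma_0^+))=\min\{m\in\mathbb N: D^md_{\sigma_i\sigma_{i+1}}(T_i(\gamma_0^+))\ne0\}$. $\overline m=\max_im(T_i(\gamma_0^+))$. *)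

theory Defs
  imports "HOL-Analysis.Analysis"
begin

text \<open>
  Throughout, functions on the horizon \<open>[0,T]\<close> are represented by total functions on
  \<^typ>\<open>real\<close> whose values outside \<open>[0,T]\<close> are irrelevant. The state space is \<open>real ^ 'n\<close>;
  the modes are indexed by a finite type \<open>'m\<close>, so controls take values in \<open>real ^ 'm\<close>.
\<close>

section \<open>Regularity\<close>

definition C2_bounded :: "real \<Rightarrow> ('a::euclidean_space \<Rightarrow> 'b::euclidean_space) \<Rightarrow> bool" where
  "C2_bounded K g \<longleftrightarrow>
     (\<exists>(Dg :: 'a \<Rightarrow> 'a \<Rightarrow>\<^sub>L 'b) (D2g :: 'a \<Rightarrow> 'a \<Rightarrow>\<^sub>L ('a \<Rightarrow>\<^sub>L 'b)).
        (\<forall>x. (g has_derivative blinfun_apply (Dg x)) (at x)) \<and>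
        (\<forall>x. (Dg has_derivative blinfun_apply (D2g x)) (at x)) \<and>
        continuous_on UNIV D2g \<and>
        (\<forall>x. norm (D2g x) \<le> K))"

text \<open>At \<open>0\<close> and \<open>T\<close> one of the two one-sided limits below is along the trivial filter.\<close>

definition piecewise_continuous :: "real \<Rightarrow> (real \<Rightarrow> 'a::real_normed_vector) \<Rightarrow> bool" where
  "piecewise_continuous T g \<longleftrightarrow>
     finite {t \<in> {0..T}. \<not> continuous (at t within {0..T}) g} \<and>
     (\<forall>t\<in>{0..T}. (\<exists>L. (g \<longlongrightarrow> L) (at t within {0..<t})) \<and>
                  (\<exists>L. (g \<longlongrightarrow> L) (at t within {t<..T})))"

definition critical_points :: "real \<Rightarrow> (real \<Rightarrow> real) \<Rightarrow> real set" where
  "critical_points T g =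
     {t \<in> {0..T}. \<not> g differentiable (at t within {0..T}) \<or>
                   (g has_real_derivative 0) (at t within {0..T})}"

definition ae_eq :: "real \<Rightarrow> (real \<Rightarrow> 'a) \<Rightarrow> (real \<Rightarrow> 'a) \<Rightarrow> bool" where
  "ae_eq T g h \<longleftrightarrow> (AE t in lebesgue. t \<in> {0..T} \<longrightarrow> g t = h t)"

section \<open>Switching controls and mode schedules\<close>

text \<open>
  \<open>ms = [\<sigma>\<^sub>1,\<dots>,\<sigma>\<^sub>M]\<close> and \<open>ts = [T\<^sub>1,\<dots>,T\<^sub>M\<^sub>-\<^sub>1]\<close>; list positions are counted from 0, so
  \<open>ms ! i\<close> is active on \<open>[(0 # ts @ [T]) ! i, (0 # ts @ [T]) ! Suc i)\<close>. Adjacent modes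
  are distinct, so every member of \<open>ts\<close> is a genuine switching time and the schedule is
  unique. The last interval is closed at \<open>T\<close>.
\<close>

definition mode_schedule :: "real \<Rightarrow> (real \<Rightarrow> real ^ 'm::finite) \<Rightarrow> 'm list \<Rightarrow> real list \<Rightarrow> bool" where
  "mode_schedule T u ms ts \<longleftrightarrow>
     length ms = Suc (length ts) \<and>
     sorted_wrt (<) (0 # ts @ [T]) \<and>
     (\<forall>i < length ts. ms ! i \<noteq> ms ! Suc i) \<and>
     (\<forall>i < length ms. \<forall>t \<in> {(0 # ts @ [T]) ! i ..< (0 # ts @ [T]) ! Suc i}.
         u t = axis (ms ! i) 1) \<and>
     u T = axis (last ms) 1"

definition non_chattering :: "real list \<Rightarrow> bool" where
  "non_chattering ts \<longleftrightarrow>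
     (\<exists>\<delta>>0. \<forall>i. Suc i < length ts \<longrightarrow> ts ! Suc i - ts ! i > \<delta>)"

text \<open>
  A switching control is only determined almost everywhere; \<open>\<Omega>\<close> contains the pointwise
  representative given by the schedule. Controls known up to null sets, such as the
  pointwise projection below (which has several unit components where the maximum is
  tied), are compared with members of \<open>\<Omega>\<close> by \<^const>\<open>ae_eq\<close>.
\<close>

definition \<Omega> :: "real \<Rightarrow> (real \<Rightarrow> real ^ 'm::finite) set" where
  "\<Omega> T = {u. \<exists>ms ts. mode_schedule T u ms ts \<and> non_chattering ts}"

definition schedule_of :: "real \<Rightarrow> (real \<Rightarrow> real ^ 'm::finite) \<Rightarrow> 'm list \<times> real list" where
  "schedule_of T w = (THE (ms, ts). \<exists>u. mode_schedule T u ms ts \<and> ae_eq T u w)"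

section \<open>Dynamics, cost, adjoint and mode insertion gradient\<close>

definition F :: "('m::finite \<Rightarrow> real ^ 'n::finite \<Rightarrow> real ^ 'n) \<Rightarrow> real ^ 'n \<Rightarrow> real ^ 'm \<Rightarrow> real ^ 'n" where
  "F f x u = (\<Sum>i\<in>UNIV. (u $ i) *\<^sub>R f i x)"

definition L1 :: "real \<Rightarrow> (real \<Rightarrow> 'a::euclidean_space) set" where
  "L1 T = {g. g absolutely_integrable_on {0..T}}"

definition \<S> :: "('m::finite \<Rightarrow> real ^ 'n::finite \<Rightarrow> real ^ 'n) \<Rightarrow> real ^ 'n \<Rightarrow> real \<Rightarrow>
    ((real \<Rightarrow> real ^ 'n) \<times> (real \<Rightarrow> real ^ 'm)) set" where
  "\<S> f x0 T = {(x, u). x \<in> L1 T \<and> u \<in> L1 T \<and> u \<in> \<Omega> T \<and>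
     (\<forall>t\<in>{0..T}. ((\<lambda>s. F f (x s) (u s)) has_integral (x t - x0)) {0..t})}"

definition J :: "(real ^ 'n::finite \<Rightarrow> real) \<Rightarrow> real \<Rightarrow>
    (real \<Rightarrow> real ^ 'n) \<times> (real \<Rightarrow> real ^ 'm::finite) \<Rightarrow> real" where
  "J l T \<xi> = integral {0..T} (\<lambda>t. l (fst \<xi> t))"

text \<open>
  Integral form of \<open>\<rho>' = - D\<^sub>1F(x,u)\<^sup>T \<rho> - Dl(x)\<^sup>T\<close>, \<open>\<rho>(T) = 0\<close>. The transpose of a
  Jacobian is the adjoint of the Frechet derivative; in particular \<open>Dl(x)\<^sup>T\<close> is the adjoint
  of the functional \<open>Dl(x)\<close> applied to \<open>1\<close>.
\<close>

definition adjoint_solution :: "('m::finite \<Rightarrow> real ^ 'n::finite \<Rightarrow> real ^ 'n) \<Rightarrow> (real ^ 'n \<Rightarrow> real) \<Rightarrow>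
    real \<Rightarrow> (real \<Rightarrow> real ^ 'n) \<Rightarrow> (real \<Rightarrow> real ^ 'm) \<Rightarrow> (real \<Rightarrow> real ^ 'n) \<Rightarrow> bool" where
  "adjoint_solution f l T x u \<rho> \<longleftrightarrow>
     (\<forall>t\<in>{0..T}.
        ((\<lambda>s. - adjoint (frechet_derivative (\<lambda>y. F f y (u s)) (at (x s))) (\<rho> s)
              - adjoint (frechet_derivative l (at (x s))) 1)
          has_integral (\<rho> T - \<rho> t)) {t..T}) \<and>
     \<rho> T = 0"

definition mode_insertion_gradient :: "('m::finite \<Rightarrow> real ^ 'n::finite \<Rightarrow> real ^ 'n) \<Rightarrow>
    (real \<Rightarrow> real ^ 'n) \<Rightarrow> (real \<Rightarrow> real ^ 'm) \<Rightarrow> (real \<Rightarrow> real ^ 'n) \<Rightarrow> real \<Rightarrow> real ^ 'm" where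
  "mode_insertion_gradient f x u \<rho> t = (\<chi> a. \<rho> t \<bullet> (f a (x t) - F f (x t) (u t)))"

section \<open>Projection\<close>

definition step :: "real \<Rightarrow> real" where
  "step s = (if s \<ge> 0 then 1 else 0)"

definition \<Q> :: "(real \<Rightarrow> real ^ 'm::finite) \<Rightarrow> real \<Rightarrow> real ^ 'm" where
  "\<Q> \<mu> t = (\<chi> i. \<Prod>j\<in>UNIV - {i}. step (\<mu> t $ i - \<mu> t $ j))"

text \<open>
  The element of \<open>\<S>\<close> whose control is \<open>\<Q> \<mu>\<close>. The choice only concerns values outside
  \<open>[0,T]\<close>: on \<open>[0,T]\<close> both the schedule representative and the trajectory are unique.
  The value does not depend on \<open>\<alpha>\<close>.
\<close>

definition \<P> :: "('m::finite \<Rightarrow> real ^ 'n::finite \<Rightarrow> real ^ 'n) \<Rightarrow> real ^ 'n \<Rightarrow> real \<Rightarrow>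
    (real \<Rightarrow> real ^ 'n) \<Rightarrow> (real \<Rightarrow> real ^ 'm) \<Rightarrow>
    (real \<Rightarrow> real ^ 'n) \<times> (real \<Rightarrow> real ^ 'm)" where
  "\<P> f x0 T \<alpha> \<mu> = (SOME (x, u). (x, u) \<in> \<S> f x0 T \<and> ae_eq T u (\<Q> \<mu>))"

section \<open>Optimality function and types of the switching times\<close>

text \<open>\<open>d\<close> may jump at switching times, so the lower bound need not be attained.\<close>

definition \<theta> :: "real \<Rightarrow> (real \<Rightarrow> real ^ 'm::finite) \<Rightarrow> real" where
  "\<theta> T d = (INF (\<sigma>, t) \<in> UNIV \<times> {0..T}. d t $ \<sigma>)"

definition \<gamma>\<^sub>0 :: "real \<Rightarrow> (real \<Rightarrow> real ^ 'm::finite) \<Rightarrow> real" where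
  "\<gamma>\<^sub>0 T d = - 1 / \<theta> T d"

definition line :: "(real \<Rightarrow> real ^ 'm::finite) \<Rightarrow> (real \<Rightarrow> real ^ 'm) \<Rightarrow> real \<Rightarrow> real \<Rightarrow> real ^ 'm" where
  "line u d \<gamma> t = u t - \<gamma> *\<^sub>R d t"

definition mode_seq :: "real \<Rightarrow> (real \<Rightarrow> real ^ 'm::finite) \<Rightarrow> (real \<Rightarrow> real ^ 'm) \<Rightarrow> real \<Rightarrow> 'm list" where
  "mode_seq T u d \<gamma> = fst (schedule_of T (\<Q> (line u d \<gamma>)))"

definition switch_times :: "real \<Rightarrow> (real \<Rightarrow> real ^ 'm::finite) \<Rightarrow> (real \<Rightarrow> real ^ 'm) \<Rightarrow> real \<Rightarrow> real list" where
  "switch_times T u d \<gamma> = snd (schedule_of T (\<Q> (line u d \<gamma>)))"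

text \<open>The constant value of the mode sequence for \<open>\<gamma>\<close> slightly above \<open>\<gamma>\<^sub>0\<close>.\<close>

definition mode_seq_right :: "real \<Rightarrow> (real \<Rightarrow> real ^ 'm::finite) \<Rightarrow> (real \<Rightarrow> real ^ 'm) \<Rightarrow> 'm list" where
  "mode_seq_right T u d = (THE ms. \<forall>\<^sub>F \<gamma> in at_right (\<gamma>\<^sub>0 T d). mode_seq T u d \<gamma> = ms)"

text \<open>
  \<open>D\<^sup>m d\<^sub>a\<^sub>b (T\<^sub>i(\<gamma>\<^sub>0\<^sup>+)) \<noteq> 0\<close>, the value at \<open>T\<^sub>i(\<gamma>\<^sub>0\<^sup>+)\<close> being the limit of the values at
  \<open>T\<^sub>i(\<gamma>)\<close>. For data with two continuous derivatives, \<open>d\<^sub>a\<^sub>b\<close> is twice differentiable away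
  from the switching times of \<open>u\<close>, so for \<open>m \<le> 2\<close> the iterated \<^const>\<open>deriv\<close> is a genuine
  derivative at the times where it is used.
\<close>

definition deriv_nonzero :: "real \<Rightarrow> (real \<Rightarrow> real ^ 'm::finite) \<Rightarrow> (real \<Rightarrow> real ^ 'm) \<Rightarrow>
    nat \<Rightarrow> 'm \<Rightarrow> 'm \<Rightarrow> nat \<Rightarrow> bool" where
  "deriv_nonzero T u d i a b m \<longleftrightarrow>
     (\<exists>L. L \<noteq> 0 \<and>
        ((\<lambda>\<gamma>. (deriv ^^ m) (\<lambda>t. d t $ a - d t $ b) (switch_times T u d \<gamma> ! i)) \<longlongrightarrow> L)
          (at_right (\<gamma>\<^sub>0 T d)))"

text \<open>
  The minimum is over \<open>m \<ge> 1\<close>: the type \<open>0\<close> is reserved for constant switching times, and at a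
  moving one \<open>d\<^sub>a\<^sub>b\<close> itself never vanishes. The minimum of the empty set is \<open>\<infinity>\<close>.
\<close>

definition switch_type :: "real \<Rightarrow> (real \<Rightarrow> real ^ 'm::finite) \<Rightarrow> (real \<Rightarrow> real ^ 'm) \<Rightarrow> nat \<Rightarrow> enat" where
  "switch_type T u d i =
     (if \<exists>c. \<forall>\<^sub>F \<gamma> in at_right (\<gamma>\<^sub>0 T d). switch_times T u d \<gamma> ! i = c then 0
      else (INF m \<in> {m. m \<ge> 1 \<and>
               deriv_nonzero T u d i (mode_seq_right T u d ! i) (mode_seq_right T u d ! Suc i) m}.
             enat m))"

definition max_type :: "real \<Rightarrow> (real \<Rightarrow> real ^ 'm::finite) \<Rightarrow> (real \<Rightarrow> real ^ 'm) \<Rightarrow> enat" where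
  "max_type T u d = Max (switch_type T u d ` {i. Suc i < length (mode_seq_right T u d)})"

end

theory Submission
  imports Defs
begin

text \<open>
  Let \<open>v\<close> be the projected control \<open>\<Q>(u - \<gamma> d)\<close> and let \<open>\<epsilon>\<close> be the length of the set of times at
  which \<open>v\<close> differs from \<open>u\<close>. The active component of \<open>d\<close> is zero, so at almost every time
  \<open>v\<close> leaves the active mode exactly when some component of \<open>d\<close> is below \<open>-1/\<gamma>\<close>, and the mode
  \<open>a\<close> that it selects there satisfies \<open>d\<^sub>a < -1/\<gamma>\<close>. As \<open>d\<^sub>a\<close> is the first-order effect on the cost of
  inserting mode \<open>a\<close>, all switched times push in the same direction:

  \<open>J(\<gamma>) - J(0) = \<integral> \<rho> \<bullet> (F(x,v) - F(x,u)) + O(\<epsilon>\<^sup>2) \<le> - \<epsilon>/\<gamma> + O(\<epsilon>\<^sup>2)\<close>.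

  This is negative as soon as \<open>\<epsilon>\<close> is positive and small. It is positive for \<open>\<gamma> > \<gamma>\<^sub>0\<close> because then
  \<open>-1/\<gamma>\<close> exceeds the infimum \<open>\<theta>\<close> of \<open>d\<close>, and \<open>d\<close> is one-sidedly continuous at every time, so a value
  below \<open>-1/\<gamma>\<close> persists on an interval (\<open>strict_inequality_persists\<close>). It tends to \<open>0\<close> as
  \<open>\<gamma> \<down> \<gamma>\<^sub>0\<close> because the sets \<open>{d\<^sub>a < -1/\<gamma>}\<close> decrease to \<open>{d\<^sub>a = \<theta>}\<close>, which is finite
  (\<open>sublevel_indicator_vanishes\<close>).

  The expansion with a quadratic remainder is \<open>cost_expansion\<close>: integrating the derivative of
  \<open>\<rho> \<bullet> (y - x)\<close>, where \<open>y\<close> is the trajectory of \<open>v\<close>, trades the linearised cost for the integral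
  above. It needs \<open>y\<close> to exist on \<open>[0,T]\<close> with \<open>\<bar>y - x\<bar> = O(\<epsilon>)\<close>. The modes may grow
  quadratically, so that an arbitrary control can make the state blow up before \<open>T\<close>; existence is
  therefore proved only near \<open>x\<close>, by freezing the modes outside a ball (\<open>nearby_trajectory\<close>).
  Finally, \<open>\<Q>(u - \<gamma> d)\<close> has to be a switching control up to a null set: its ties lie on level sets of
  the differences \<open>d\<^sub>i - d\<^sub>j\<close>, and by Rolle's theorem a function with finitely many critical points
  takes each value finitely often (\<open>finite_level_set\<close>, \<open>Q_line_locally_constant\<close>).
\<close>

section \<open>Piecewise constant controls and mode schedules\<close>

text \<open>
  The neighbourhood filter includes \<open>t\<close> itself, so \<open>w t\<close> is a unit vector too. The endpoints are
  excluded, and \<open>w\<close> is arbitrary on \<open>C\<close>: this describes projected controls, which are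
  not unit vectors where the maximum is tied.
\<close>
definition piecewise_mode :: "real \<Rightarrow> real set \<Rightarrow> (real \<Rightarrow> real ^ 'm::finite) \<Rightarrow> bool" where
  "piecewise_mode T C w \<longleftrightarrow>
     finite C \<and> (\<forall>t\<in>{0<..<T} - C. \<exists>a. \<forall>\<^sub>F s in nhds t. w s = axis a 1)"

text \<open>
  The transfer principle behind all regularity statements below: near \<open>t\<close> the control is a fixed
  unit vector, so continuity has to be checked for constant modes only.
\<close>
lemma piecewise_mode_isCont:
  assumes "piecewise_mode T C w" "t \<in> {0<..<T} - C"
    and "\<And>a. isCont (\<lambda>s. H s (axis a 1)) t"
  shows "isCont (\<lambda>s. H s (w s)) t"
proof -
  obtain a where "\<forall>\<^sub>F s in nhds t. w s = axis a 1"
    using assms(1,2) unfolding piecewise_mode_def by blast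
  then have "\<forall>\<^sub>F s in nhds t. H s (w s) = H s (axis a 1)"
    by (rule eventually_mono) simp
  then show ?thesis using assms(3)[of a] isCont_cong[of "\<lambda>s. H s (w s)" "\<lambda>s. H s (axis a 1)" t] by simp
qed

text \<open>
  A locally constant function has derivative zero, hence is constant on an interval.
\<close>
lemma piecewise_mode_constant:
  fixes w :: "real \<Rightarrow> real ^ 'm::finite"
  assumes "piecewise_mode T C w" "p < q" "{p<..<q} \<subseteq> {0<..<T} - C"
  shows "\<exists>a. \<forall>t\<in>{p<..<q}. w t = axis a 1"
proof -
  have loc: "\<exists>a. \<forall>\<^sub>F s in nhds t. w s = axis a 1" if "t \<in> {p<..<q}" for t
    using assms(1,3) that unfolding piecewise_mode_def by (meson subsetD)
  have "(w has_vector_derivative 0) (at t within {p<..<q})" if t: "t \<in> {p<..<q}" for t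
  proof -
    obtain a where a: "\<forall>\<^sub>F s in nhds t. w s = axis a 1" using loc[OF t] by blast
    have ev: "\<forall>\<^sub>F s in nhds t. s \<in> {p<..<q} \<longrightarrow> w s = axis a 1"
      using a by (rule eventually_mono) simp
    have "w t = axis a 1" using eventually_nhds_x_imp_x[OF a] .
    from has_vector_derivative_cong_ev[OF ev this] show ?thesis by simp
  qed
  then obtain c where c: "\<And>t. t \<in> {p<..<q} \<Longrightarrow> w t = c"
    using has_vector_derivative_zero_constant[of "{p<..<q}" w] by blast
  have m: "(p + q) / 2 \<in> {p<..<q}" using assms(2) by auto
  obtain a where "w ((p + q) / 2) = axis a 1"
    using loc[OF m] eventually_nhds_x_imp_x by blast
  then show ?thesis using c m by metis
qed

lemma interval_index:
  fixes c :: "real list"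
  assumes "c ! 0 \<le> t" "t < c ! n"
  shows "\<exists>i<n. c ! i \<le> t \<and> t < c ! Suc i"
  using assms(2)
proof (induction n)
  case 0
  then show ?case using assms(1) by simp
next
  case (Suc n)
  then show ?case by (cases "t < c ! n") (auto intro: less_SucI)
qed

text \<open>
  Finds the interval of the schedule that contains \<open>t\<close>. Its left end is \<open>0\<close> or a switching time,
  so at any other \<open>t\<close> the interval is a neighbourhood of \<open>t\<close>.
\<close>
lemma mode_schedule_index:
  assumes "mode_schedule T u ms ts" "t \<in> {0..<T}"
  shows "\<exists>p q a. p \<in> insert 0 (set ts) \<and> p \<le> t \<and> t < q \<and> q \<le> T \<and> (\<forall>s\<in>{p..<q}. u s = axis a 1)"
proof -
  let ?c = "0 # ts @ [T]"
  have ms: "length ms = Suc (length ts)" and so: "sorted_wrt (<) ?c"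
    and eq: "\<And>i. i < length ms \<Longrightarrow> \<forall>t \<in> {?c ! i ..< ?c ! Suc i}. u t = axis (ms ! i) 1"
    using assms(1) unfolding mode_schedule_def by blast+
  have "?c ! Suc (length ts) = T" by (simp add: nth_append)
  then obtain i where i: "i < Suc (length ts)" "?c ! i \<le> t" "t < ?c ! Suc i"
    using interval_index[of ?c t "Suc (length ts)"] assms(2) by auto
  have "?c ! i \<in> insert 0 (set ts)"
    using i(1) by (cases i) (auto simp: nth_append)
  moreover have "?c ! Suc i \<le> T"
    using so i(1) by (auto simp: sorted_wrt_append nth_append less_Suc_eq intro: less_imp_le)
  ultimately show ?thesis using i eq[of i] ms by metis
qed

text \<open>
  The intervals of a schedule are closed on the left, which gives right-continuity before \<open>T\<close>; the
  last one is closed at \<open>T\<close> as well, which gives left-continuity there.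
\<close>
lemma Omega_cases:
  assumes "u \<in> \<Omega> T"
  obtains C where "T > 0" "piecewise_mode T C u"
    "\<And>t. t \<in> {0..T} \<Longrightarrow> \<exists>a. u t = axis a 1"
    "\<And>t. t \<in> {0..<T} \<Longrightarrow> \<forall>\<^sub>F s in at_right t. u s = u t"
    "\<forall>\<^sub>F s in at_left T. u s = u T"
proof -
  obtain ms ts where m: "mode_schedule T u ms ts"
    using assms unfolding \<Omega>_def by blast
  let ?c = "0 # ts @ [T]"
  have so: "sorted_wrt (<) ?c" and len: "length ms = Suc (length ts)"
    and eq: "\<And>i. i < length ms \<Longrightarrow> \<forall>t \<in> {?c ! i ..< ?c ! Suc i}. u t = axis (ms ! i) 1"
    and uT: "u T = axis (last ms) 1"
    using m unfolding mode_schedule_def by blast+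
  have T: "T > 0" using so by auto
  have 1: "piecewise_mode T (set ts) u"
    unfolding piecewise_mode_def
  proof (intro conjI ballI)
    fix t assume t: "t \<in> {0<..<T} - set ts"
    then obtain p q a where p: "p \<in> insert 0 (set ts)" "p \<le> t" "t < q" "\<forall>s\<in>{p..<q}. u s = axis a 1"
      using mode_schedule_index[OF m, of t] by force
    have "p < t" using p t by (cases "p = t") auto
    then have "\<forall>\<^sub>F s in nhds t. s \<in> {p<..<q}"
      using p by (intro eventually_nhds_in_open) auto
    then have "\<forall>\<^sub>F s in nhds t. u s = axis a 1"
      by (rule eventually_mono) (use p in auto)
    then show "\<exists>a. \<forall>\<^sub>F s in nhds t. u s = axis a 1" by blast
  qed simp
  have 2: "\<exists>a. u t = axis a 1" if "t \<in> {0..T}" for t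
  proof (cases "t = T")
    case False
    then show ?thesis using mode_schedule_index[OF m, of t] that by fastforce
  qed (use uT in auto)
  have 3: "\<forall>\<^sub>F s in at_right t. u s = u t" if t: "t \<in> {0..<T}" for t
  proof -
    obtain p q a where p: "p \<le> t" "t < q" "\<forall>s\<in>{p..<q}. u s = axis a 1"
      using mode_schedule_index[OF m t] by force
    then show ?thesis unfolding eventually_at_right_field by (intro exI[of _ q]) auto
  qed
  have 4: "\<forall>\<^sub>F s in at_left T. u s = u T"
  proof -
    let ?p = "?c ! length ts"
    have "?p < T" using so by (cases ts rule: rev_cases) (auto simp: sorted_wrt_append nth_append)
    moreover have "\<forall>t\<in>{?p..<T}. u t = axis (last ms) 1"
      using eq[of "length ts"] len last_conv_nth[of ms]
      by (cases "ms = []") (auto simp: nth_append)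
    ultimately show ?thesis unfolding eventually_at_left_field
      by (intro exI[of _ ?p]) (auto simp: uT)
  qed
  show ?thesis using that[OF T 1 2 3 4] .
qed

lemma Omega_piecewise: "u \<in> \<Omega> T \<Longrightarrow> \<exists>C. piecewise_mode T C u"
  by (erule Omega_cases) (rule exI)

lemma Omega_axis: "u \<in> \<Omega> T \<Longrightarrow> t \<in> {0..T} \<Longrightarrow> \<exists>a. u t = axis a 1"
  by (erule Omega_cases) blast

lemma Omega_right: "u \<in> \<Omega> T \<Longrightarrow> t \<in> {0..<T} \<Longrightarrow> \<forall>\<^sub>F s in at_right t. u s = u t"
  by (erule Omega_cases) blast

lemma Omega_left: "u \<in> \<Omega> T \<Longrightarrow> \<forall>\<^sub>F s in at_left T. u s = u T"
  by (erule Omega_cases)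

text \<open>
  Induction on the largest exceptional time \<open>b\<close>: a schedule on \<open>[0,b]\<close> is continued to the horizon
  \<open>T\<close> by the constant mode on \<open>(b,T)\<close>. Schedules have distinct adjacent modes, so \<open>b\<close> becomes a
  switching time only if that mode differs from the last one.
\<close>
lemma mode_schedule_exists:
  fixes w :: "real \<Rightarrow> real ^ 'm::finite"
  assumes "finite C" "C \<subseteq> {0<..<T}" "T > 0" "piecewise_mode T C w"
  shows "\<exists>u ms ts. mode_schedule T u ms ts \<and> (\<forall>t\<in>{0<..<T} - C. u t = w t)"
  using assms
proof (induction arbitrary: T rule: finite_linorder_max_induct)
  case empty
  obtain a where "\<forall>t\<in>{0<..<T}. w t = axis a 1"
    using piecewise_mode_constant[of T "{}" w 0 T] empty by auto
  then have "mode_schedule T (\<lambda>_. axis a 1 :: real ^ 'm) [a] [] \<and> (\<forall>t\<in>{0<..<T} - {}. axis a 1 = w t)"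
    using empty by (auto simp: mode_schedule_def)
  then show ?case by blast
next
  case (insert b A)
  have b: "0 < b" "b < T" using insert.prems by auto
  have pm: "piecewise_mode b A w"
    unfolding piecewise_mode_def
  proof (intro conjI ballI)
    fix t assume "t \<in> {0<..<b} - A"
    then have "t \<in> {0<..<T} - insert b A" using b by auto
    then show "\<exists>a. \<forall>\<^sub>F s in nhds t. w s = axis a 1"
      using insert.prems(3) unfolding piecewise_mode_def by blast
  qed (fact insert.hyps)
  obtain u ms ts where m: "mode_schedule b u ms ts" and uw: "\<forall>t\<in>{0<..<b} - A. u t = w t"
    using insert.IH[OF _ b(1) pm] insert.hyps insert.prems by force
  have "{b<..<T} \<subseteq> {0<..<T} - insert b A" using insert.hyps b by fastforce
  then obtain a where a: "\<forall>t\<in>{b<..<T}. w t = axis a 1"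
    using piecewise_mode_constant[OF insert.prems(3) b(2)] by blast
  define v where "v = (\<lambda>t. if t < b then u t else axis a 1)"
  have vw: "\<forall>t\<in>{0<..<T} - insert b A. v t = w t"
    using uw a insert.hyps by (auto simp: v_def)
  let ?c = "0 # ts @ [b]"
  have so: "sorted_wrt (<) ?c" and len: "length ms = Suc (length ts)"
    and ne: "\<forall>i < length ts. ms ! i \<noteq> ms ! Suc i"
    and eq: "\<And>i. i < length ms \<Longrightarrow> \<forall>t \<in> {?c ! i ..< ?c ! Suc i}. u t = axis (ms ! i) 1"
    using m unfolding mode_schedule_def by blast+
  have lms: "last ms = ms ! length ts" using len last_conv_nth[of ms] by (cases "ms = []") simp_all
  have tsb: "\<forall>s\<in>set ts. s < b" using so by (auto simp: sorted_wrt_append)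
  show ?case
  proof (cases "last ms = a")
    case True
    have "mode_schedule T v ms ts"
      unfolding mode_schedule_def
    proof (intro conjI allI impI ballI)
      show "sorted_wrt (<) (0 # ts @ [T])"
        using so tsb b by (auto simp: sorted_wrt_append)
      fix i t assume i: "i < length ms" and t: "t \<in> {(0 # ts @ [T]) ! i..<(0 # ts @ [T]) ! Suc i}"
      have ci: "(0 # ts @ [T]) ! i = ?c ! i"
        using i len by (cases i) (auto simp: nth_append)
      show "v t = axis (ms ! i) 1"
      proof (cases "i = length ts")
        case True
        then have "?c ! Suc i = b" by (auto simp: nth_append)
        moreover have "ms ! i = a" using \<open>last ms = a\<close> lms True by simp
        ultimately show ?thesis using t ci eq[OF i] by (auto simp: v_def)
      next
        case False
        then have "i < length ts" using i len by simp
        then have "(0 # ts @ [T]) ! Suc i = ts ! i" "?c ! Suc i = ts ! i" "ts ! i < b"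
          using tsb by (auto simp: nth_append)
        then show ?thesis using t ci eq[OF i] by (auto simp: v_def)
      qed
    qed (use len ne True b in \<open>auto simp: v_def\<close>)
    then show ?thesis using vw by blast
  next
    case False
    have "mode_schedule T v (ms @ [a]) (ts @ [b])"
      unfolding mode_schedule_def
    proof (intro conjI allI impI ballI)
      show "sorted_wrt (<) (0 # (ts @ [b]) @ [T])"
        using so tsb b by (auto simp: sorted_wrt_append)
      show "(ms @ [a]) ! i \<noteq> (ms @ [a]) ! Suc i" if "i < length (ts @ [b])" for i
        using that ne False len lms
        by (cases "i = length ts") (auto simp: nth_append)
      fix i t assume i: "i < length (ms @ [a])"
        and t: "t \<in> {(0 # (ts @ [b]) @ [T]) ! i..<(0 # (ts @ [b]) @ [T]) ! Suc i}"
      show "v t = axis ((ms @ [a]) ! i) 1"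
      proof (cases "i = length ms")
        case True
        then have "(0 # (ts @ [b]) @ [T]) ! i = b" using len by (simp add: nth_append)
        then show ?thesis using t True by (auto simp: v_def)
      next
        case False
        then have i': "i < length ms" using i by simp
        have "(0 # (ts @ [b]) @ [T]) ! i = ?c ! i" "(0 # (ts @ [b]) @ [T]) ! Suc i = ?c ! Suc i"
          using i' len by (cases i; auto simp: nth_append)+
        moreover have "?c ! Suc i \<le> b"
          using i' len tsb by (cases "i = length ts") (auto simp: nth_append intro: less_imp_le)
        ultimately show ?thesis using t eq[OF i'] i' by (auto simp: v_def nth_append)
      qed
    qed (use len b in \<open>auto simp: v_def\<close>)
    then show ?thesis using vw by blast
  qed
qed

text \<open>
  A finite list of increasing times has a least gap; half of it makes the bound strict.
\<close>
lemma sorted_non_chattering: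
  assumes "sorted_wrt (<) ts"
  shows "non_chattering ts"
proof -
  \<comment> \<open>The element \<open>1\<close> keeps the minimum defined for lists without gaps.\<close>
  let ?D = "insert 1 ((\<lambda>i. ts ! Suc i - ts ! i) ` {i. Suc i < length ts})"
  have fin: "finite ?D"
    by (intro finite.insertI finite_imageI) (rule finite_subset[of _ "{..length ts}"], auto)
  have "\<forall>r\<in>?D. r > 0" using assms by (auto simp: sorted_wrt_iff_nth_less)
  then have pos: "Min ?D > 0" using fin by (subst Min_gr_iff) auto
  have "Min ?D / 2 < ts ! Suc i - ts ! i" if "Suc i < length ts" for i
  proof -
    have "Min ?D \<le> ts ! Suc i - ts ! i" using that by (intro Min_le fin) auto
    then show ?thesis using pos by linarith
  qed
  then show ?thesis unfolding non_chattering_def using pos by (intro exI[of _ "Min ?D / 2"]) auto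
qed

text \<open>
  Turns the local description of a control into membership of \<open>\<Omega>\<close>.
\<close>
lemma Omega_representative:
  fixes w :: "real \<Rightarrow> real ^ 'm::finite"
  assumes "piecewise_mode T C w" "T > 0"
  shows "\<exists>u\<in>\<Omega> T. ae_eq T u w"
proof -
  let ?C = "C \<inter> {0<..<T}"
  have fin: "finite C" using assms(1) unfolding piecewise_mode_def by blast
  have "piecewise_mode T ?C w" using assms(1) unfolding piecewise_mode_def by auto
  then obtain u ms ts where m: "mode_schedule T u ms ts" and uw: "\<forall>t\<in>{0<..<T} - ?C. u t = w t"
    using mode_schedule_exists[of ?C T w] assms(2) fin by auto
  have "sorted_wrt (<) ts" using m unfolding mode_schedule_def by (auto simp: sorted_wrt_append)
  then have "u \<in> \<Omega> T" using m sorted_non_chattering unfolding \<Omega>_def by blast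
  moreover have "ae_eq T u w"
    unfolding ae_eq_def
  proof (rule AE_I')
    show "C \<union> {0, T} \<in> null_sets lebesgue"
      using fin negligible_finite negligible_iff_null_sets by blast
    show "{t \<in> space lebesgue. \<not> (t \<in> {0..T} \<longrightarrow> u t = w t)} \<subseteq> C \<union> {0, T}"
      using uw by fastforce
  qed
  ultimately show ?thesis by blast
qed

section \<open>Integrating along a switching control\<close>

lemma F_axis: "F f x (axis a 1) = f a x"
proof -
  have "F f x (axis a 1) = (\<Sum>i\<in>UNIV. if i = a then f i x else 0)"
    unfolding F_def axis_def by (intro sum.cong) auto
  then show ?thesis by simp
qed

lemma integrable_piecewise:
  fixes g :: "real \<Rightarrow> 'a::euclidean_space"
  assumes "finite C" "\<And>t. t \<in> {0<..<T} - C \<Longrightarrow> isCont g t"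
    and "\<And>t. t \<in> {0<..<T} - C \<Longrightarrow> norm (g t) \<le> B"
  shows "g absolutely_integrable_on {0..T}"
proof -
  let ?S = "{0<..<T} - C"
  have S: "?S \<in> sets lebesgue"
    using assms(1) by (intro sets.Diff) (auto simp: negligible_finite negligible_imp_sets)
  have "continuous_on ?S g" using assms(2) by (simp add: continuous_at_imp_continuous_on)
  then have m: "g \<in> borel_measurable (lebesgue_on ?S)"
    using continuous_imp_measurable_on_sets_lebesgue S by blast
  have "?S \<in> lmeasurable"
    by (rule bounded_set_imp_lmeasurable[OF _ S]) (rule bounded_subset[of "{0..T}"], auto)
  then have "(\<lambda>t. B) integrable_on ?S" using integrable_on_const by blast
  then have "g absolutely_integrable_on ?S"
    using measurable_bounded_by_integrable_imp_absolutely_integrable[OF m S] assms(3) by blast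
  then show ?thesis
  proof (rule absolutely_integrable_spike_set)
    show "negligible {t \<in> {0..T} - ?S. g t \<noteq> 0}"
      by (rule negligible_subset[of "C \<union> {0, T}"]) (use assms(1) in auto)
    have "{t \<in> ?S - {0..T}. g t \<noteq> 0} = {}" by auto
    then show "negligible {t \<in> ?S - {0..T}. g t \<noteq> 0}" by (metis negligible_empty)
  qed
qed

lemma finite_family_bound:
  fixes g :: "'m::finite \<Rightarrow> real \<Rightarrow> 'b::real_normed_vector"
  assumes "\<And>a. continuous_on {0..T} (g a)"
  obtains B where "B > 0" "\<And>a t. t \<in> {0..T} \<Longrightarrow> norm (g a t) \<le> B"
proof -
  have "bounded (\<Union>a. g a ` {0..T})"
    using assms by (intro bounded_UN) (auto intro!: compact_imp_bounded compact_continuous_image)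
  then obtain B where "B > 0" "\<forall>y\<in>(\<Union>a. g a ` {0..T}). norm y \<le> B"
    unfolding bounded_pos by auto
  then show ?thesis using that[of B] by auto
qed

text \<open>
  Integrands seen through a switching control are bounded and continuous up to finitely many times.
\<close>
lemma integrable_controlled:
  fixes H :: "real \<Rightarrow> real ^ 'm::finite \<Rightarrow> 'a::euclidean_space"
  assumes u: "u \<in> \<Omega> T" and H: "\<And>a. continuous_on {0..T} (\<lambda>t. H t (axis a 1))"
  shows "(\<lambda>t. H t (u t)) absolutely_integrable_on {0..T}"
proof -
  obtain C where C: "piecewise_mode T C u" using Omega_piecewise[OF u] by blast
  obtain B where B: "\<And>a t. t \<in> {0..T} \<Longrightarrow> norm (H t (axis a 1)) \<le> B"
    using finite_family_bound[of T "\<lambda>a t. H t (axis a 1)", OF H] by blast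
  show ?thesis
  proof (rule integrable_piecewise)
    show "finite C" using C unfolding piecewise_mode_def by blast
    fix t assume t: "t \<in> {0<..<T} - C"
    show "isCont (\<lambda>t. H t (u t)) t"
    proof (rule piecewise_mode_isCont[OF C t, where H = H])
      show "isCont (\<lambda>s. H s (axis a 1)) t" for a
        using continuous_on_interior[OF H, of t a] t by simp
    qed
    show "norm (H t (u t)) \<le> B" using Omega_axis[OF u, of t] B[of t] t by force
  qed
qed

lemma Omega_integrable: "u \<in> \<Omega> T \<Longrightarrow> u \<in> L1 T"
  using integrable_controlled[of u T "\<lambda>t w. w"] by (simp add: L1_def)

text \<open>
  The length of the set of times where two controls differ, written as an integral. It is the size
  of the perturbation in all estimates below.
\<close>
definition mismatch :: "real \<Rightarrow> (real \<Rightarrow> 'a) \<Rightarrow> (real \<Rightarrow> 'a) \<Rightarrow> real" where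
  "mismatch T u v = integral {0..T} (\<lambda>t. if u t = v t then 0 else 1)"

lemma integrable_mismatch:
  assumes "u \<in> \<Omega> T" "v \<in> \<Omega> T"
  shows "(\<lambda>t. if u t = v t then 0 else 1 :: real) absolutely_integrable_on {0..T}"
proof -
  obtain C D where C: "piecewise_mode T C u" and D: "piecewise_mode T D v"
    using Omega_piecewise assms by blast
  show ?thesis
  proof (rule integrable_piecewise)
    show "finite (C \<union> D)" using C D unfolding piecewise_mode_def by blast
    fix t assume t: "t \<in> {0<..<T} - (C \<union> D)"
    have "isCont (\<lambda>s. if w = v s then 0 else 1 :: real) t" for w
      by (rule piecewise_mode_isCont[OF D, where H = "\<lambda>s z. if w = z then 0 else 1 :: real"]) (use t in auto)
    then show "isCont (\<lambda>s. if u s = v s then 0 else 1 :: real) t"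
      using t by (intro piecewise_mode_isCont[OF C, where H = "\<lambda>s w. if w = v s then 0 else 1 :: real"]) auto
    show "norm (if u t = v t then 0 else 1 :: real) \<le> 1" by simp
  qed
qed

lemma mismatch_indicator_integral:
  assumes "u \<in> \<Omega> T" "v \<in> \<Omega> T" "t \<in> {0..T}"
  shows "(\<lambda>s. if u s = v s then 0 else 1 :: real) integrable_on {0..t}"
    and "integral {0..t} (\<lambda>s. if u s = v s then 0 else 1) \<le> mismatch T u v"
    and "0 \<le> mismatch T u v"
proof -
  have i: "(\<lambda>s. if u s = v s then 0 else 1 :: real) integrable_on {0..T}"
    by (rule set_lebesgue_integral_eq_integral(1)[OF integrable_mismatch[OF assms(1,2)]])
  show j: "(\<lambda>s. if u s = v s then 0 else 1 :: real) integrable_on {0..t}"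
    by (rule integrable_subinterval_real[OF i]) (use assms(3) in auto)
  show "integral {0..t} (\<lambda>s. if u s = v s then 0 else 1) \<le> mismatch T u v"
    unfolding mismatch_def by (rule integral_subset_le[OF _ j i]) (use assms in auto)
  show "0 \<le> mismatch T u v"
    unfolding mismatch_def by (rule integral_nonneg[OF i]) auto
qed

lemma primitive_continuous:
  fixes X :: "real \<Rightarrow> 'a::banach"
  assumes "\<And>t. t \<in> {0..T} \<Longrightarrow> (q has_integral (X t - c)) {0..t}"
  shows "continuous_on {0..T} X"
proof (cases "0 \<le> T")
  case True
  have i: "q integrable_on {0..T}" and e: "\<And>t. t \<in> {0..T} \<Longrightarrow> X t = c + integral {0..t} q"
    using assms True by (auto simp: has_integral_iff)
  have "continuous_on {0..T} (\<lambda>t. c + integral {0..t} q)"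
    by (intro continuous_intros indefinite_integral_continuous_1 i)
  then show ?thesis by (rule continuous_on_eq) (simp add: e)
qed simp

lemma primitive_has_vector_derivative:
  fixes X :: "real \<Rightarrow> 'a::banach"
  assumes X: "\<And>t. t \<in> {0..T} \<Longrightarrow> (q has_integral (X t - c)) {0..t}"
    and t: "t \<in> {0<..<T}" and q: "isCont q t"
  shows "(X has_vector_derivative q t) (at t)"
proof -
  have i: "q integrable_on {0..T}" and e: "\<And>t. t \<in> {0..T} \<Longrightarrow> X t = c + integral {0..t} q"
    using X t by (auto simp: has_integral_iff)
  have "((\<lambda>s. integral {0..s} q) has_vector_derivative q t) (at t within ({0..T} - {}))"
    by (rule integral_has_vector_derivative_continuous_at[OF i])
      (use t q in \<open>auto intro: continuous_at_imp_continuous_at_within\<close>)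
  then have "((\<lambda>s. integral {0..s} q) has_vector_derivative q t) (at t)"
    using t by (simp add: at_within_Icc_at)
  then have d: "((\<lambda>s. c + integral {0..s} q) has_vector_derivative q t) (at t)"
    by (auto intro!: derivative_eq_intros)
  have "\<forall>\<^sub>F s in nhds t. s \<in> {0<..<T}" using t by (intro eventually_nhds_in_open) auto
  then have ev: "\<forall>\<^sub>F s in nhds t. s \<in> UNIV \<longrightarrow> X s = c + integral {0..s} q"
    by (rule eventually_mono) (use e in auto)
  have "X t = c + integral {0..t} q" using e t by auto
  from has_vector_derivative_cong_ev[OF ev this] show ?thesis using d by simp
qed

section \<open>Trajectories: stability and existence\<close>

text \<open>
  The dynamics of \<^const>\<open>\<S>\<close> alone, separated from the membership conditions on \<open>x\<close> and \<open>u\<close>.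
\<close>
definition trajectory :: "('m::finite \<Rightarrow> real ^ 'n::finite \<Rightarrow> real ^ 'n) \<Rightarrow> real ^ 'n \<Rightarrow> real \<Rightarrow>
    (real \<Rightarrow> real ^ 'n) \<Rightarrow> (real \<Rightarrow> real ^ 'm) \<Rightarrow> bool" where
  "trajectory f x0 T x u \<longleftrightarrow>
     (\<forall>t\<in>{0..T}. ((\<lambda>s. F f (x s) (u s)) has_integral (x t - x0)) {0..t})"

lemma trajectory_continuous:
  assumes "trajectory f x0 T x u" "0 \<le> T"
  shows "continuous_on {0..T} x" "x 0 = x0"
proof -
  have p: "((\<lambda>s. F f (x s) (u s)) has_integral (x t - x0)) {0..t}" if "t \<in> {0..T}" for t
    using assms(1) that unfolding trajectory_def by blast
  show "continuous_on {0..T} x" by (rule primitive_continuous[OF p])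
  show "x 0 = x0" using p[of 0] assms(2) by (simp add: has_integral_iff)
qed

lemma trajectory_cong:
  assumes "\<And>a s. s \<in> {0..T} \<Longrightarrow> f a (x s) = g a (x s)"
  shows "trajectory f x0 T x u \<longleftrightarrow> trajectory g x0 T x u"
proof -
  have "((\<lambda>s. F f (x s) (u s)) has_integral I) {0..t} \<longleftrightarrow> ((\<lambda>s. F g (x s) (u s)) has_integral I) {0..t}"
    if "t \<in> {0..T}" for t I
    by (rule has_integral_cong) (use assms that in \<open>simp add: F_def\<close>)
  then show ?thesis unfolding trajectory_def by simp
qed

lemma integral_exp_le:
  fixes k :: real
  assumes "k > 0" "0 \<le> t"
  shows "(\<lambda>s. exp (k * s)) integrable_on {0..t}" "integral {0..t} (\<lambda>s. exp (k * s)) \<le> exp (k * t) / k"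
proof -
  have "((\<lambda>s. exp (k * s)) has_integral (exp (k * t) / k - exp (k * 0) / k)) {0..t}"
    using assms by (intro fundamental_theorem_of_calculus)
      (auto intro!: derivative_eq_intros simp: has_real_derivative_iff_has_vector_derivative[symmetric])
  then show "(\<lambda>s. exp (k * s)) integrable_on {0..t}" "integral {0..t} (\<lambda>s. exp (k * s)) \<le> exp (k * t) / k"
    using assms by (auto simp: has_integral_iff)
qed

text \<open>
  Gronwall's estimate by way of a weighted maximum: if \<open>e\<^sup>-\<^sup>2\<^sup>L\<^sup>t \<bar>y - x\<bar>\<close> has its maximum \<open>m\<close> at \<open>r\<close>, then
  the Lipschitz part of the difference of the integral equations contributes at most \<open>m/2\<close> at \<open>r\<close>
  and can be absorbed, while the mismatch of the controls contributes \<open>2B\<close> times its length. The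
  Lipschitz bound is required only along the two trajectories, so the lemma applies to modes that
  are not globally Lipschitz.
\<close>
lemma trajectory_stable:
  fixes g :: "'m::finite \<Rightarrow> real ^ 'n::finite \<Rightarrow> real ^ 'n"
  assumes T: "T > 0" and u: "u \<in> \<Omega> T" and v: "v \<in> \<Omega> T"
    and x: "trajectory g x0 T x u" and y: "trajectory g x0 T y v"
    and L: "L > 0" "\<And>a s. s \<in> {0..T} \<Longrightarrow> norm (g a (y s) - g a (x s)) \<le> L * norm (y s - x s)"
    and B: "\<And>a s. s \<in> {0..T} \<Longrightarrow> norm (g a (x s)) \<le> B"
    and t: "t \<in> {0..T}"
  shows "norm (y t - x t) \<le> 4 * B * exp (2 * L * T) * mismatch T u v"
proof -
  let ?e = "mismatch T u v" and ?k = "2 * L"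
  let ?\<chi> = "\<lambda>s. if u s = v s then 0 else 1 :: real"
  have e0: "0 \<le> ?e" by (rule mismatch_indicator_integral(3)[OF u v t])
  have B0: "0 \<le> B" using order_trans[OF norm_ge_zero B[OF t]] .
  have cx: "continuous_on {0..T} x" and cy: "continuous_on {0..T} y"
    using trajectory_continuous(1)[OF x] trajectory_continuous(1)[OF y] T by simp_all
  define \<phi> where "\<phi> = (\<lambda>t. exp (- ?k * t) * norm (y t - x t))"
  have "continuous_on {0..T} \<phi>" unfolding \<phi>_def by (intro continuous_intros cx cy)
  then obtain r where r: "r \<in> {0..T}" and M: "\<And>s. s \<in> {0..T} \<Longrightarrow> \<phi> s \<le> \<phi> r"
    using continuous_attains_sup[of "{0..T}" \<phi>] T by auto
  have xM: "norm (y s - x s) \<le> \<phi> r * exp (?k * s)" if "s \<in> {0..T}" for s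
  proof -
    have "norm (y s - x s) = \<phi> s * exp (?k * s)"
      by (simp add: \<phi>_def exp_minus)
    then show ?thesis using M[OF that] by simp
  qed
  have int: "((\<lambda>s. F g (y s) (v s) - F g (x s) (u s)) has_integral (y r - x r)) {0..r}"
  proof -
    have "((\<lambda>s. F g (y s) (v s) - F g (x s) (u s)) has_integral (y r - x0 - (x r - x0))) {0..r}"
      using x y r unfolding trajectory_def by (intro has_integral_diff) blast+
    then show ?thesis by simp
  qed
  have ie: "(\<lambda>s. exp (?k * s)) integrable_on {0..r}"
    "integral {0..r} (\<lambda>s. exp (?k * s)) \<le> exp (?k * r) / ?k"
    using integral_exp_le[of ?k r] L r by auto
  have im: "?\<chi> integrable_on {0..r}" "integral {0..r} ?\<chi> \<le> ?e"
    by (rule mismatch_indicator_integral(1,2)[OF u v r])+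
  have "norm (y r - x r) = norm (integral {0..r} (\<lambda>s. F g (y s) (v s) - F g (x s) (u s)))"
    using int by (simp add: has_integral_iff)
  also have "\<dots> \<le> integral {0..r} (\<lambda>s. (L * \<phi> r) * exp (?k * s) + (2 * B) * ?\<chi> s)"
  proof (rule integral_norm_bound_integral)
    show "(\<lambda>s. F g (y s) (v s) - F g (x s) (u s)) integrable_on {0..r}"
      using int by blast
    show "(\<lambda>s. (L * \<phi> r) * exp (?k * s) + (2 * B) * ?\<chi> s) integrable_on {0..r}"
      by (intro integrable_add integrable_on_mult_right ie im)
    fix s assume "s \<in> {0..r}"
    then have s: "s \<in> {0..T}" using r by auto
    obtain a b where a: "u s = axis a 1" and b: "v s = axis b 1"
      using Omega_axis[OF u s] Omega_axis[OF v s] by blast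
    have "norm (g b (y s) - g a (x s)) \<le> norm (g b (y s) - g b (x s)) + norm (g b (x s) - g a (x s))"
      using norm_triangle_ineq[of "g b (y s) - g b (x s)" "g b (x s) - g a (x s)"] by simp
    moreover have "norm (g b (y s) - g b (x s)) \<le> L * \<phi> r * exp (?k * s)"
    proof -
      have "L * norm (y s - x s) \<le> L * (\<phi> r * exp (?k * s))"
        using xM[OF s] L(1) by simp
      then show ?thesis using L(2)[OF s, of b] by (simp add: mult.assoc)
    qed
    moreover have "norm (g b (x s) - g a (x s)) \<le> 2 * B * ?\<chi> s"
    proof (cases "u s = v s")
      case True
      then have "g b (x s) = g a (x s)" using a b F_axis[of g "x s"] by metis
      then show ?thesis using True by simp
    next
      case False
      then show ?thesis using norm_triangle_ineq4[of "g b (x s)" "g a (x s)"] B[OF s, of a] B[OF s, of b]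
        by simp
    qed
    ultimately show "norm (F g (y s) (v s) - F g (x s) (u s)) \<le> (L * \<phi> r) * exp (?k * s) + (2 * B) * ?\<chi> s"
      unfolding a b F_axis by linarith
  qed
  also have "\<dots> = (L * \<phi> r) * integral {0..r} (\<lambda>s. exp (?k * s)) + (2 * B) * integral {0..r} ?\<chi>"
    by (subst integral_add) (intro integrable_on_mult_right ie im integral_mult_right | simp only: integral_mult_right)+
  also have "\<dots> \<le> (L * \<phi> r) * (exp (?k * r) / ?k) + (2 * B) * ?e"
  proof -
    have "0 \<le> \<phi> r" by (simp add: \<phi>_def)
    then show ?thesis using L(1) B0 ie im by (intro add_mono mult_left_mono) auto
  qed
  finally have "norm (y r - x r) \<le> \<phi> r * exp (?k * r) / 2 + 2 * B * ?e"
    using L(1) by (simp add: field_simps)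
  moreover have "norm (y r - x r) = \<phi> r * exp (?k * r)"
    by (simp add: \<phi>_def exp_minus)
  ultimately have "\<phi> r * exp (?k * r) \<le> 4 * B * ?e" by simp
  moreover have "\<phi> r * 1 \<le> \<phi> r * exp (?k * r)"
    using L r by (intro mult_left_mono) (auto simp: \<phi>_def)
  ultimately have "\<phi> r \<le> 4 * B * ?e" by simp
  then have "\<phi> r * exp (?k * t) \<le> 4 * B * ?e * exp (?k * T)"
    using L t B0 e0 by (intro mult_mono) auto
  then show ?thesis using xM[OF t] by (simp add: mult_ac)
qed

text \<open>
  Picard's operator for the function \<open>z(t) = e\<^sup>-\<^sup>2\<^sup>L\<^sup>t y(t)\<close> is a contraction with constant \<open>1/2\<close> in the supremum
  norm, on the whole horizon at once. To use the Banach space of bounded continuous functions on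
  the real line, time is clamped to \<open>[0,T]\<close> by \<open>c\<close>.
\<close>
lemma trajectory_exists:
  fixes g :: "'m::finite \<Rightarrow> real ^ 'n::finite \<Rightarrow> real ^ 'n"
  assumes T: "T > 0" and v: "v \<in> \<Omega> T"
    and L: "L > 0" "\<And>a x y. norm (g a y - g a x) \<le> L * norm (y - x)"
  shows "\<exists>y. trajectory g x0 T y v"
proof -
  let ?k = "2 * L"
  define c where "c = (\<lambda>t. max 0 (min t T))"
  have c: "c t \<in> {0..T}" for t using T by (auto simp: c_def)
  have cc: "continuous_on UNIV c" unfolding c_def by (intro continuous_intros)
  have gc: "continuous_on S (g a)" for a and S
  proof (rule continuous_on_subset)
    have "L-lipschitz_on UNIV (g a)"
      using L by (intro lipschitz_onI) (auto simp: dist_norm norm_minus_commute)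
    then show "continuous_on UNIV (g a)" by (rule lipschitz_on_continuous_on)
  qed simp
  define N where "N = (\<lambda>(z :: real \<Rightarrow>\<^sub>C (real ^ 'n)) s. F g (exp (?k * s) *\<^sub>R z s) (v s))"
  have Ni: "N z integrable_on {0..T}" for z
    unfolding N_def
    by (rule set_lebesgue_integral_eq_integral(1), rule integrable_controlled[OF v, where H = "\<lambda>s w. F g (exp (?k * s) *\<^sub>R z s) w"])
      (unfold F_axis, rule continuous_on_compose2[OF gc[of UNIV]], auto intro!: continuous_intros)
  define h where "h = (\<lambda>z t. exp (- ?k * t) *\<^sub>R (x0 + integral {0..t} (N z)))"
  have hc: "continuous_on {0..T} (h z)" for z
    unfolding h_def by (intro continuous_intros indefinite_integral_continuous_1 Ni)
  have hb: "(\<lambda>t. h z (c t)) \<in> bcontfun" for z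
  proof -
    have "bounded (h z ` {0..T})"
      by (intro compact_imp_bounded compact_continuous_image hc) auto
    then obtain b where "\<forall>t\<in>{0..T}. norm (h z t) \<le> b" unfolding bounded_iff by auto
    moreover have "continuous_on UNIV (\<lambda>t. h z (c t))"
      by (rule continuous_on_compose2[OF hc cc]) (use c in auto)
    ultimately show ?thesis using bcontfun_normI[of "\<lambda>t. h z (c t)" b] c by blast
  qed
  define \<Phi> where "\<Phi> = (\<lambda>z. Bcontfun (\<lambda>t. h z (c t)))"
  have \<Phi>: "apply_bcontfun (\<Phi> z) t = h z (c t)" for z t
    unfolding \<Phi>_def by (simp add: Bcontfun_inverse[OF hb])
  have "dist (\<Phi> z) (\<Phi> z') \<le> (1/2) * dist z z'" for z z'
  proof (rule dist_bound)
    fix t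
    let ?r = "c t" and ?D = "dist z z'"
    have sub: "{0..?r} \<subseteq> {0..T}" using c[of t] by auto
    have i: "N z integrable_on {0..?r}" "N z' integrable_on {0..?r}"
      using integrable_subinterval_real[OF Ni sub] by auto
    have ie: "(\<lambda>s. exp (?k * s)) integrable_on {0..?r}"
      "integral {0..?r} (\<lambda>s. exp (?k * s)) \<le> exp (?k * ?r) / ?k"
      using integral_exp_le[of ?k ?r] L(1) c[of t] by auto
    have "norm (integral {0..?r} (\<lambda>s. N z s - N z' s)) \<le> integral {0..?r} (\<lambda>s. (L * ?D) * exp (?k * s))"
    proof (rule integral_norm_bound_integral)
      show "(\<lambda>s. N z s - N z' s) integrable_on {0..?r}" by (intro integrable_diff i)
      show "(\<lambda>s. (L * ?D) * exp (?k * s)) integrable_on {0..?r}" by (intro integrable_on_mult_right ie)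
      fix s assume s: "s \<in> {0..?r}"
      then obtain a where a: "v s = axis a 1" using Omega_axis[OF v, of s] sub by blast
      have "norm (N z s - N z' s) \<le> L * norm (exp (?k * s) *\<^sub>R z s - exp (?k * s) *\<^sub>R z' s)"
        unfolding N_def a F_axis by (rule L(2))
      also have "\<dots> = L * (exp (?k * s) * dist (z s) (z' s))"
        by (simp add: dist_norm scaleR_diff_right[symmetric])
      also have "\<dots> \<le> L * (exp (?k * s) * ?D)"
        using L(1) dist_bounded[of z s z'] by (intro mult_left_mono) auto
      finally show "norm (N z s - N z' s) \<le> (L * ?D) * exp (?k * s)" by (simp add: mult_ac)
    qed
    also have "\<dots> = (L * ?D) * integral {0..?r} (\<lambda>s. exp (?k * s))" by (rule integral_mult_right)
    also have "\<dots> \<le> (L * ?D) * (exp (?k * ?r) / ?k)"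
      using L(1) ie by (intro mult_left_mono) auto
    also have "\<dots> = exp (?k * ?r) * (1/2 * ?D)" using L(1) by simp
    finally have le: "norm (integral {0..?r} (\<lambda>s. N z s - N z' s)) \<le> exp (?k * ?r) * (1/2 * ?D)" .
    have "dist (\<Phi> z t) (\<Phi> z' t) = exp (- ?k * ?r) * norm (integral {0..?r} (\<lambda>s. N z s - N z' s))"
      unfolding \<Phi> h_def dist_norm scaleR_diff_right[symmetric] integral_diff[OF i] by simp
    also have "\<dots> \<le> exp (- ?k * ?r) * (exp (?k * ?r) * (1/2 * ?D))"
      using le by (intro mult_left_mono) auto
    also have "\<dots> = 1/2 * ?D" by (simp add: exp_minus)
    finally show "dist (\<Phi> z t) (\<Phi> z' t) \<le> (1/2) * dist z z'" .
  qed
  then obtain z where z: "\<Phi> z = z" using banach_fix_type[of "1/2" \<Phi>] by auto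
  define y where "y = (\<lambda>s. exp (?k * s) *\<^sub>R z s)"
  have "((\<lambda>s. F g (y s) (v s)) has_integral (y t - x0)) {0..t}" if t: "t \<in> {0..T}" for t
  proof -
    have "c t = t" using t by (auto simp: c_def)
    then have "z t = h z t" using \<Phi>[of z t] z by simp
    then have "y t = x0 + integral {0..t} (N z)" by (simp add: y_def h_def exp_minus)
    moreover have "N z integrable_on {0..t}"
      by (rule integrable_subinterval_real[OF Ni]) (use t in auto)
    ultimately have "(N z has_integral (y t - x0)) {0..t}" by (simp add: has_integral_iff)
    then show ?thesis by (simp add: N_def y_def)
  qed
  then show ?thesis unfolding trajectory_def by blast
qed

section \<open>Bounded second derivatives\<close>

text \<open>
  The second derivative enters only through these consequences: a continuous derivative and a
  first-order Taylor expansion with quadratic remainder. The factor \<open>1/2\<close> is given away.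
\<close>
lemma C2_bounded_expansion:
  assumes "C2_bounded K g"
  obtains Dg where "\<forall>x. (g has_derivative blinfun_apply (Dg x)) (at x)"
    and "continuous_on UNIV Dg" and "K \<ge> 0"
    and "\<forall>x y. norm (g y - g x - Dg x (y - x)) \<le> K * norm (y - x) ^ 2"
proof -
  obtain Dg D2g where d: "\<And>x. (g has_derivative blinfun_apply (Dg x)) (at x)"
    and d2: "\<And>x. (Dg has_derivative blinfun_apply (D2g x)) (at x)" and K: "\<And>x. norm (D2g x) \<le> K"
    using assms unfolding C2_bounded_def by blast
  have c: "continuous_on UNIV Dg"
    using d2 has_derivative_continuous by (intro continuous_at_imp_continuous_on) blast
  have K0: "K \<ge> 0" using order_trans[OF norm_ge_zero K] .
  have lip: "norm (Dg y - Dg x) \<le> K * norm (y - x)" for x y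
    by (rule differentiable_bound[of UNIV Dg "\<lambda>x. blinfun_apply (D2g x)"])
      (use d2 K in \<open>auto simp: norm_blinfun.rep_eq[symmetric]\<close>)
  have "norm (g y - g x - Dg x (y - x)) \<le> K * norm (y - x) ^ 2" for x y
  proof -
    have "norm (g y - g x - Dg x (y - x)) \<le> norm (y - x) * (K * norm (y - x))"
    proof (rule differentiable_bound_linearization[where S = "closed_segment x y" and f' = "\<lambda>z. blinfun_apply (Dg z)"])
      show "x + t *\<^sub>R (y - x) \<in> closed_segment x y" if "t \<in> {0..1}" for t
        using that unfolding in_segment by (intro exI[of _ t]) (auto simp: algebra_simps)
      show "(g has_derivative blinfun_apply (Dg z)) (at z within closed_segment x y)" for z
        using d by (rule has_derivative_at_withinI)
      fix z assume z: "z \<in> closed_segment x y"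
      have "onorm (blinfun_apply (Dg z) - blinfun_apply (Dg x)) = norm (Dg z - Dg x)"
        by (simp add: norm_blinfun.rep_eq minus_blinfun.rep_eq fun_diff_def)
      also have "\<dots> \<le> K * norm (z - x)" by (rule lip)
      also have "\<dots> \<le> K * norm (y - x)"
        using segment_bound(1)[OF z] K0 by (simp add: mult_left_mono)
      finally show "onorm (blinfun_apply (Dg z) - blinfun_apply (Dg x)) \<le> K * norm (y - x)" .
    qed auto
    then show ?thesis by (simp add: power2_eq_square mult_ac)
  qed
  then show ?thesis using that[OF _ c K0] d by blast
qed

lemma C2_bounded_continuous: "C2_bounded K g \<Longrightarrow> continuous_on S g"
  by (erule C2_bounded_expansion)
    (meson continuous_at_imp_continuous_on has_derivative_continuous)

lemma C2_bounded_lipschitz_on_cball: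
  fixes f :: "'m::finite \<Rightarrow> real ^ 'n::finite \<Rightarrow> real ^ 'n"
  assumes "\<And>i. C2_bounded K (f i)"
  obtains L where "L > 0"
    "\<And>i x y. x \<in> cball 0 R \<Longrightarrow> y \<in> cball 0 R \<Longrightarrow> norm (f i y - f i x) \<le> L * norm (y - x)"
proof -
  have "\<exists>L. \<forall>x\<in>cball 0 R. \<forall>y\<in>cball 0 R. norm (f i y - f i x) \<le> L * norm (y - x)" for i
  proof -
    obtain Dg where d: "\<forall>x. (f i has_derivative blinfun_apply (Dg x)) (at x)"
      and c: "continuous_on UNIV Dg"
      by (rule C2_bounded_expansion[OF assms[of i]]) (rule that)
    have "bounded (Dg ` cball 0 R)"
      by (intro compact_imp_bounded compact_continuous_image continuous_on_subset[OF c]) auto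
    then obtain L where L: "\<forall>x\<in>cball 0 R. norm (Dg x) \<le> L"
      unfolding bounded_iff by auto
    have "norm (f i y - f i x) \<le> L * norm (y - x)" if "x \<in> cball 0 R" "y \<in> cball 0 R" for x y
      by (rule differentiable_bound[of "cball 0 R" "f i" "\<lambda>x. blinfun_apply (Dg x)"])
        (use d L that in \<open>simp_all add: norm_blinfun.rep_eq[symmetric] has_derivative_at_withinI\<close>)
    then show ?thesis by blast
  qed
  then obtain L where L: "\<And>i x y. x \<in> cball 0 R \<Longrightarrow> y \<in> cball 0 R \<Longrightarrow> norm (f i y - f i x) \<le> L i * norm (y - x)"
    by metis
  let ?L = "1 + (\<Sum>i\<in>UNIV. \<bar>L i\<bar>)"
  have "?L > 0" by (rule add_pos_nonneg) (auto intro: sum_nonneg)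
  moreover have "norm (f i y - f i x) \<le> ?L * norm (y - x)" if "x \<in> cball 0 R" "y \<in> cball 0 R" for i x y
  proof -
    have "L i \<le> \<bar>L i\<bar>" by simp
    also have "\<dots> \<le> (\<Sum>i\<in>UNIV. \<bar>L i\<bar>)" by (rule member_le_sum) auto
    finally have "L i * norm (y - x) \<le> ?L * norm (y - x)" by (intro mult_right_mono) auto
    then show ?thesis using L[OF that, of i] by simp
  qed
  ultimately show ?thesis using that by blast
qed

section \<open>Trajectories close to a given one\<close>

lemma continuous_on_Icc_bound:
  fixes x :: "real \<Rightarrow> 'a::euclidean_space"
  assumes "continuous_on {0..T} x"
  obtains R where "R > 0" "\<forall>t\<in>{0..T}. norm (x t) \<le> R"
proof -
  have "bounded (x ` {0..T})"
    by (intro compact_imp_bounded compact_continuous_image assms) auto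
  then obtain R where "R > 0" "\<forall>y\<in>x ` {0..T}. norm y \<le> R" unfolding bounded_pos by auto
  then show ?thesis using that[of R] by auto
qed

text \<open>
  A bound on the second derivative allows quadratic growth, so the modes are only locally
  Lipschitz. Composing them with the projection \<open>\<pi>\<close> onto a ball that contains the trajectory \<open>x\<close>
  with a margin of \<open>1\<close> makes them globally Lipschitz. The resulting trajectory \<open>y\<close> stays within
  \<open>C \<epsilon> < 1\<close> of \<open>x\<close>, hence inside the ball, where the modified modes are the original ones.
\<close>
lemma nearby_trajectory:
  fixes f :: "'m::finite \<Rightarrow> real ^ 'n::finite \<Rightarrow> real ^ 'n"
  assumes T: "T > 0" and f: "\<And>i. C2_bounded K (f i)"
    and u: "u \<in> \<Omega> T" and x: "trajectory f x0 T x u"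
  shows "\<exists>\<eta>>0. \<exists>C\<ge>0. \<forall>v\<in>\<Omega> T. mismatch T u v < \<eta> \<longrightarrow>
    (\<exists>y. trajectory f x0 T y v \<and> (\<forall>t\<in>{0..T}. norm (y t - x t) \<le> C * mismatch T u v))"
proof -
  have cx: "continuous_on {0..T} x" using trajectory_continuous(1)[OF x] T by simp
  obtain R0 where R0: "R0 > 0" "\<forall>t\<in>{0..T}. norm (x t) \<le> R0"
    by (rule continuous_on_Icc_bound[OF cx])
  let ?R = "R0 + 1"
  obtain L where L: "L > 0" "\<And>i x y. x \<in> cball 0 ?R \<Longrightarrow> y \<in> cball 0 ?R \<Longrightarrow> norm (f i y - f i x) \<le> L * norm (y - x)"
    by (rule C2_bounded_lipschitz_on_cball[OF f]) (rule that)
  define \<pi> :: "real ^ 'n \<Rightarrow> real ^ 'n" where "\<pi> = closest_point (cball 0 ?R)"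
  define g where "g = (\<lambda>a z. f a (\<pi> z))"
  have ne: "cball (0 :: real ^ 'n) ?R \<noteq> {}" using R0(1) by simp
  have \<pi>: "\<pi> z \<in> cball 0 ?R" "norm (\<pi> z - \<pi> z') \<le> norm (z - z')" for z z'
    using closest_point_in_set[OF closed_cball ne] closest_point_lipschitz[OF convex_cball closed_cball ne]
    by (auto simp: \<pi>_def dist_norm)
  have \<pi>_id: "\<pi> z = z" if "norm z \<le> ?R" for z
    using that by (simp add: \<pi>_def closest_point_self)
  have gL: "norm (g a z - g a z') \<le> L * norm (z - z')" for a z z'
  proof -
    have "norm (g a z - g a z') \<le> L * norm (\<pi> z - \<pi> z')" unfolding g_def by (rule L(2)[OF \<pi>(1) \<pi>(1)])
    also have "\<dots> \<le> L * norm (z - z')" using L(1) \<pi>(2) by (simp add: mult_left_mono)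
    finally show ?thesis .
  qed
  have "f a (x s) = g a (x s)" if "s \<in> {0..T}" for a s
    using \<pi>_id[of "x s"] R0(2) that by (force simp: g_def)
  then have xg: "trajectory g x0 T x u" using trajectory_cong[of T f x g] x by blast
  have "continuous_on {0..T} (\<lambda>t. f a (x t))" for a
    by (rule continuous_on_compose2[OF C2_bounded_continuous[OF f, of UNIV] cx]) simp
  then obtain B where B: "B > 0" "\<And>a t. t \<in> {0..T} \<Longrightarrow> norm (f a (x t)) \<le> B"
    using finite_family_bound[of T "\<lambda>a t. f a (x t)"] by blast
  define C where "C = 4 * B * exp (2 * L * T)"
  have C: "C > 0" using B(1) by (simp add: C_def)
  have "\<exists>y. trajectory f x0 T y v \<and> (\<forall>t\<in>{0..T}. norm (y t - x t) \<le> C * mismatch T u v)"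
    if v: "v \<in> \<Omega> T" and small: "mismatch T u v < 1 / C" for v
  proof -
    obtain y where y: "trajectory g x0 T y v" using trajectory_exists[OF T v L(1), where g = g, OF gL] by blast
    have yx: "norm (y t - x t) \<le> C * mismatch T u v" if t: "t \<in> {0..T}" for t
      unfolding C_def
    proof (rule trajectory_stable[OF T u v xg y L(1) gL _ t])
      show "norm (g a (x s)) \<le> B" if "s \<in> {0..T}" for a s
        using B(2)[OF that] \<pi>_id[of "x s"] R0(2) that by (force simp: g_def)
    qed
    have "C * mismatch T u v \<le> 1" using small C by (simp add: field_simps)
    then have "norm (y t) \<le> ?R" if "t \<in> {0..T}" for t
      using yx[OF that] R0(2) that norm_triangle_ineq[of "y t - x t" "x t"] by force
    then have "f a (y s) = g a (y s)" if "s \<in> {0..T}" for a s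
      using \<pi>_id that by (simp add: g_def)
    then have "trajectory f x0 T y v" using trajectory_cong[of T f y g] y by blast
    then show ?thesis using yx by blast
  qed
  then show ?thesis using C by (intro exI[of _ "1 / C"] conjI exI[of _ C]) auto
qed

text \<open>
  Two given trajectories lie in a common ball, where the modes are Lipschitz; stability with
  mismatch zero identifies them.
\<close>
lemma trajectory_unique:
  fixes f :: "'m::finite \<Rightarrow> real ^ 'n::finite \<Rightarrow> real ^ 'n"
  assumes T: "T > 0" and f: "\<And>i. C2_bounded K (f i)"
    and u: "u \<in> \<Omega> T" and v: "v \<in> \<Omega> T" and uv: "mismatch T u v = 0"
    and x: "trajectory f x0 T x u" and y: "trajectory f x0 T y v" and t: "t \<in> {0..T}"
  shows "y t = x t"
proof -
  have cx: "continuous_on {0..T} x" and cy: "continuous_on {0..T} y"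
    using trajectory_continuous(1)[OF x] trajectory_continuous(1)[OF y] T by simp_all
  obtain R1 where R1: "R1 > 0" "\<forall>t\<in>{0..T}. norm (x t) \<le> R1"
    by (rule continuous_on_Icc_bound[OF cx])
  obtain R2 where R2: "R2 > 0" "\<forall>t\<in>{0..T}. norm (y t) \<le> R2"
    by (rule continuous_on_Icc_bound[OF cy])
  let ?R = "max R1 R2"
  obtain L where L: "L > 0" "\<And>i x y. x \<in> cball 0 ?R \<Longrightarrow> y \<in> cball 0 ?R \<Longrightarrow> norm (f i y - f i x) \<le> L * norm (y - x)"
    by (rule C2_bounded_lipschitz_on_cball[OF f]) (rule that)
  have "continuous_on {0..T} (\<lambda>t. f a (x t))" for a
    by (rule continuous_on_compose2[OF C2_bounded_continuous[OF f, of UNIV] cx]) simp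
  then obtain B where B: "B > 0" "\<And>a t. t \<in> {0..T} \<Longrightarrow> norm (f a (x t)) \<le> B"
    using finite_family_bound[of T "\<lambda>a t. f a (x t)"] by blast
  have "norm (y t - x t) \<le> 4 * B * exp (2 * L * T) * mismatch T u v"
  proof (rule trajectory_stable[OF T u v x y L(1) _ B(2) t])
    show "norm (f a (y s) - f a (x s)) \<le> L * norm (y s - x s)" if "s \<in> {0..T}" for a s
      using L(2)[of "x s" "y s" a] R1(2) R2(2) that by (auto simp: le_max_iff_disj)
  qed
  then show ?thesis using uv by simp
qed

section \<open>First-order expansion of the cost\<close>

text \<open>
  Makes the transposed Jacobians of the adjoint equation accessible through inner products.
\<close>
lemma adjoint_frechet_derivative_inner:
  fixes g :: "'a::euclidean_space \<Rightarrow> 'b::euclidean_space"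
  assumes "(g has_derivative D) (at x)"
  shows "adjoint (frechet_derivative g (at x)) p \<bullet> h = p \<bullet> D h"
  using adjoint_works[of D h p] has_derivative_linear[OF assms] frechet_derivative_at[OF assms]
  by (simp add: inner_commute)

lemma continuous_on_inner_components:
  fixes g :: "'b::topological_space \<Rightarrow> 'a::euclidean_space"
  assumes "\<And>b. continuous_on S (\<lambda>t. g t \<bullet> b)"
  shows "continuous_on S g"
proof -
  have "continuous_on S (\<lambda>t. \<Sum>b\<in>Basis. (g t \<bullet> b) *\<^sub>R b)"
    by (intro continuous_intros assms)
  then show ?thesis by (simp add: euclidean_representation)
qed

text \<open>
  The adjoint equation is given backwards from \<open>T\<close>; this is its forward form, to which the results
  on primitives apply.
\<close>
lemma adjoint_solution_primitive:
  fixes \<rho> :: "real \<Rightarrow> real ^ 'n::finite"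
  assumes "adjoint_solution f l T x u \<rho>" "t \<in> {0..T}"
  shows "((\<lambda>s. - adjoint (frechet_derivative (\<lambda>y. F f y (u s)) (at (x s))) (\<rho> s)
              - adjoint (frechet_derivative l (at (x s))) 1) has_integral (\<rho> t - \<rho> 0)) {0..t}"
proof -
  define q where "q = (\<lambda>s. - adjoint (frechet_derivative (\<lambda>y. F f y (u s)) (at (x s))) (\<rho> s)
              - adjoint (frechet_derivative l (at (x s))) 1)"
  have q: "(q has_integral (\<rho> T - \<rho> t)) {t..T}" if "t \<in> {0..T}" for t
    using assms(1) that unfolding adjoint_solution_def q_def by blast
  have 0: "q integrable_on {0..T}" "integral {0..T} q = \<rho> T - \<rho> 0"
    using q[of 0] assms(2) by (auto simp: has_integral_iff)
  have i: "q integrable_on {0..t}"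
    by (rule integrable_subinterval_real[OF 0(1)]) (use assms(2) in auto)
  have "integral {0..t} q + integral {t..T} q = integral {0..T} q"
    by (rule Henstock_Kurzweil_Integration.integral_combine[OF _ _ 0(1)]) (use assms(2) in auto)
  then have "integral {0..t} q = integral {0..T} q - integral {t..T} q" by (simp add: eq_diff_eq)
  also have "\<dots> = \<rho> t - \<rho> 0" using q[OF assms(2)] 0(2) by (simp add: has_integral_iff)
  finally have "integral {0..t} q = \<rho> t - \<rho> 0" .
  then show ?thesis unfolding q_def[symmetric] using i by (simp add: has_integral_iff)
qed

text \<open>
  Write \<open>h = y - x\<close> and \<open>A\<close> for the Jacobian of \<open>F(\<cdot>,u)\<close> at \<open>x\<close>. Since \<open>\<rho> \<bullet> h\<close> vanishes at
  \<open>0\<close> and at \<open>T\<close>, the integral of its derivative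

  \<open>\<rho>' \<bullet> h + \<rho> \<bullet> h' = - \<rho> \<bullet> A h - Dl(x) h + \<rho> \<bullet> (F(y,v) - F(x,u))\<close>

  is zero. Adding it to \<open>l(y) - l(x) - \<rho> \<bullet> (F(x,v) - F(x,u))\<close> leaves the Taylor remainder of \<open>l\<close>
  and \<open>\<rho> \<bullet> (F(y,v) - F(x,v) - A h)\<close>. The latter is the Taylor remainder of one mode where
  \<open>v = u\<close>, and where \<open>v \<noteq> u\<close> it has in addition a term of order \<open>\<bar>h\<bar>\<close>, because \<open>A\<close> belongs to the
  wrong mode there; that term is integrated over a set of length \<open>mismatch T u v\<close>.
\<close>
lemma cost_expansion:
  fixes f :: "'m::finite \<Rightarrow> real ^ 'n::finite \<Rightarrow> real ^ 'n"
  assumes T: "T > 0" and f: "\<And>i. C2_bounded K (f i)" and l: "C2_bounded K' l"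
    and u: "u \<in> \<Omega> T" and x: "trajectory f x0 T x u" and \<rho>: "adjoint_solution f l T x u \<rho>"
  shows "\<exists>M\<ge>0. \<forall>v\<in>\<Omega> T. \<forall>y r. trajectory f x0 T y v \<and> (\<forall>t\<in>{0..T}. norm (y t - x t) \<le> r) \<longrightarrow>
    \<bar>integral {0..T} (\<lambda>t. l (y t)) - integral {0..T} (\<lambda>t. l (x t))
      - integral {0..T} (\<lambda>t. \<rho> t \<bullet> (F f (x t) (v t) - F f (x t) (u t)))\<bar>
    \<le> M * (r\<^sup>2 + r * mismatch T u v)"
proof -
  have "\<exists>D. (\<forall>x. (f i has_derivative blinfun_apply (D x)) (at x)) \<and> continuous_on UNIV D \<and>
    K \<ge> 0 \<and> (\<forall>x y. norm (f i y - f i x - D x (y - x)) \<le> K * norm (y - x) ^ 2)" for i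
    by (rule C2_bounded_expansion[OF f[of i]]) blast
  then obtain Df where df: "\<And>i x. (f i has_derivative blinfun_apply (Df i x)) (at x)"
    and cDf: "\<And>i. continuous_on UNIV (Df i)" and K: "K \<ge> 0"
    and ef: "\<And>i x y. norm (f i y - f i x - Df i x (y - x)) \<le> K * norm (y - x) ^ 2"
    by metis
  obtain Dl where dl: "\<forall>x. (l has_derivative blinfun_apply (Dl x)) (at x)"
    and cDl: "continuous_on UNIV Dl" and K': "K' \<ge> 0"
    and el: "\<forall>x y. norm (l y - l x - Dl x (y - x)) \<le> K' * norm (y - x) ^ 2"
    by (rule C2_bounded_expansion[OF l])
  define H where "H = (\<lambda>s w. - adjoint (frechet_derivative (\<lambda>y. F f y w) (at (x s))) (\<rho> s)
              - adjoint (frechet_derivative l (at (x s))) 1)"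
  have q: "((\<lambda>s. H s (u s)) has_integral (\<rho> t - \<rho> 0)) {0..t}" if "t \<in> {0..T}" for t
    unfolding H_def by (rule adjoint_solution_primitive[OF \<rho> that])
  have \<rho>T: "\<rho> T = 0" using \<rho> unfolding adjoint_solution_def by blast
  have c\<rho>: "continuous_on {0..T} \<rho>" by (rule primitive_continuous[OF q])
  have cx: "continuous_on {0..T} x" using trajectory_continuous(1)[OF x] T by simp
  have cf: "continuous_on {0..T} (\<lambda>t. f a (z t))" if "continuous_on {0..T} z" for a z
    by (rule continuous_on_compose2[OF C2_bounded_continuous[OF f, of UNIV] that]) simp
  have cl: "continuous_on {0..T} (\<lambda>t. l (z t))" if "continuous_on {0..T} z" for z
    by (rule continuous_on_compose2[OF C2_bounded_continuous[OF l, of UNIV] that]) simp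
  have cDfx: "continuous_on {0..T} (\<lambda>t. Df a (x t))" for a
    by (rule continuous_on_compose2[OF cDf cx]) simp
  have cDlx: "continuous_on {0..T} (\<lambda>t. Dl (x t))"
    by (rule continuous_on_compose2[OF cDl cx]) simp
  have Hin: "H s (axis a 1) \<bullet> h = - (\<rho> s \<bullet> Df a (x s) h) - Dl (x s) h" for s a h
  proof -
    have "(\<lambda>y. F f y (axis a 1)) = f a" by (rule ext) (rule F_axis)
    then show ?thesis
      unfolding H_def inner_diff_left inner_minus_left
      using adjoint_frechet_derivative_inner[OF df, of a "x s" "\<rho> s" h]
        adjoint_frechet_derivative_inner[of l "Dl (x s)" "x s" 1 h] dl by simp
  qed
  have cH: "continuous_on {0..T} (\<lambda>t. H t (axis a 1))" for a
    by (rule continuous_on_inner_components)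
      (unfold Hin, intro continuous_intros c\<rho> cDfx cDlx)
  obtain P where P: "P > 0" "\<forall>t\<in>{0..T}. norm (\<rho> t) \<le> P"
    by (rule continuous_on_Icc_bound[OF c\<rho>])
  obtain D where D: "D > 0" "\<And>a t. t \<in> {0..T} \<Longrightarrow> norm (Df a (x t)) \<le> D"
    using finite_family_bound[of T "\<lambda>a t. Df a (x t)", OF cDfx] by blast
  define M where "M = T * (K' + P * K) + 2 * P * D"
  have M: "M \<ge> 0" using T K K' P D by (simp add: M_def)
  have "\<bar>integral {0..T} (\<lambda>t. l (y t)) - integral {0..T} (\<lambda>t. l (x t))
      - integral {0..T} (\<lambda>t. \<rho> t \<bullet> (F f (x t) (v t) - F f (x t) (u t)))\<bar>
    \<le> M * (r\<^sup>2 + r * mismatch T u v)"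
    if v: "v \<in> \<Omega> T" and y: "trajectory f x0 T y v" and r: "\<forall>t\<in>{0..T}. norm (y t - x t) \<le> r" for v y r
  proof -
    have cy: "continuous_on {0..T} y" using trajectory_continuous(1)[OF y] T by simp
    have r0: "r \<ge> 0" using order_trans[OF norm_ge_zero, of "y 0 - x 0" r] r T by simp
    let ?\<chi> = "\<lambda>s. if u s = v s then 0 else 1 :: real"
    let ?h = "\<lambda>s. y s - x s"
    let ?dh = "\<lambda>s. F f (y s) (v s) - F f (x s) (u s)"
    let ?w = "\<lambda>s. H s (u s) \<bullet> ?h s + \<rho> s \<bullet> ?dh s"
    obtain C where C: "piecewise_mode T C u" using Omega_piecewise[OF u] by blast
    obtain E where E: "piecewise_mode T E v" using Omega_piecewise[OF v] by blast
    have fin: "finite (C \<union> E)" using C E unfolding piecewise_mode_def by blast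
    have px: "((\<lambda>s. F f (x s) (u s)) has_integral (x t - x0)) {0..t}" if "t \<in> {0..T}" for t
      using x that unfolding trajectory_def by blast
    have py: "((\<lambda>s. F f (y s) (v s)) has_integral (y t - x0)) {0..t}" if "t \<in> {0..T}" for t
      using y that unfolding trajectory_def by blast
    have w: "(?w has_integral 0) {0..T}"
    proof -
      have "(?w has_integral (\<rho> T \<bullet> ?h T - \<rho> 0 \<bullet> ?h 0)) {0..T}"
      proof (rule fundamental_theorem_of_calculus_interior_strong[OF fin])
        show "continuous_on {0..T} (\<lambda>s. \<rho> s \<bullet> ?h s)" by (intro continuous_intros c\<rho> cx cy)
        fix t assume t: "t \<in> {0<..<T} - (C \<union> E)"
        then have t': "t \<in> {0<..<T}" "t \<in> {0<..<T} - C" "t \<in> {0<..<T} - E" by auto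
        have int: "isCont z t" if "continuous_on {0..T} z" for z :: "real \<Rightarrow> real ^ 'n"
          using continuous_on_interior[OF that, of t] t by simp
        have "isCont (\<lambda>s. H s (u s)) t"
          by (rule piecewise_mode_isCont[OF C t'(2), where H = H]) (rule int[OF cH])
        from primitive_has_vector_derivative[OF q t'(1) this]
        have d1: "(\<rho> has_vector_derivative H t (u t)) (at t)" .
        have "isCont (\<lambda>s. F f (x s) (u s)) t"
          by (rule piecewise_mode_isCont[OF C t'(2), where H = "\<lambda>s. F f (x s)"])
            (unfold F_axis, rule int[OF cf[OF cx]])
        from primitive_has_vector_derivative[OF px t'(1) this]
        have d2: "(x has_vector_derivative F f (x t) (u t)) (at t)" .
        have "isCont (\<lambda>s. F f (y s) (v s)) t"
          by (rule piecewise_mode_isCont[OF E t'(3), where H = "\<lambda>s. F f (y s)"])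
            (unfold F_axis, rule int[OF cf[OF cy]])
        from primitive_has_vector_derivative[OF py t'(1) this]
        have d3: "(y has_vector_derivative F f (y t) (v t)) (at t)" .
        have d4: "(?h has_vector_derivative ?dh t) (at t)"
          by (rule has_vector_derivative_diff[OF d3 d2])
        show "((\<lambda>s. \<rho> s \<bullet> ?h s) has_vector_derivative ?w t) (at t)"
          using bounded_bilinear.has_vector_derivative[OF bounded_bilinear_inner d1 d4]
          by (simp add: add.commute)
      qed (use T in auto)
      moreover have "?h 0 = 0"
        using trajectory_continuous(2)[OF x] trajectory_continuous(2)[OF y] T by simp
      ultimately show ?thesis using \<rho>T by simp
    qed
    have il: "(\<lambda>t. l (y t)) integrable_on {0..T}" "(\<lambda>t. l (x t)) integrable_on {0..T}"
      by (intro integrable_continuous_real cl cx cy)+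
    have i\<rho>: "(\<lambda>t. \<rho> t \<bullet> F f (x t) (z t)) integrable_on {0..T}" if "z \<in> \<Omega> T" for z
      by (rule set_lebesgue_integral_eq_integral(1),
          rule integrable_controlled[OF that, where H = "\<lambda>t w. \<rho> t \<bullet> F f (x t) w"])
        (unfold F_axis, intro continuous_intros c\<rho> cf[OF cx])
    have i1: "(\<lambda>t. \<rho> t \<bullet> (F f (x t) (v t) - F f (x t) (u t))) integrable_on {0..T}"
      unfolding inner_diff_right by (intro integrable_diff i\<rho> u v)
    let ?res = "\<lambda>t. l (y t) - l (x t) - \<rho> t \<bullet> (F f (x t) (v t) - F f (x t) (u t)) + ?w t"
    have res: "(?res has_integral (integral {0..T} (\<lambda>t. l (y t)) - integral {0..T} (\<lambda>t. l (x t))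
      - integral {0..T} (\<lambda>t. \<rho> t \<bullet> (F f (x t) (v t) - F f (x t) (u t))) + 0)) {0..T}"
      by (intro has_integral_add has_integral_diff w integrable_integral il i1)
    have i\<chi>: "?\<chi> integrable_on {0..T}" "integral {0..T} ?\<chi> = mismatch T u v" "0 \<le> mismatch T u v"
      using mismatch_indicator_integral[OF u v, of T] T by (auto simp: mismatch_def)
    have "norm (integral {0..T} ?res) \<le> integral {0..T} (\<lambda>s. (K' + P * K) * r\<^sup>2 + (2 * P * D * r) * ?\<chi> s)"
    proof (rule integral_norm_bound_integral)
      show "?res integrable_on {0..T}" using res by blast
      show "(\<lambda>s. (K' + P * K) * r\<^sup>2 + (2 * P * D * r) * ?\<chi> s) integrable_on {0..T}"
        by (intro integrable_add integrable_on_mult_right i\<chi> integrable_const_ivl)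
      fix s assume s: "s \<in> {0..T}"
      obtain a where a: "u s = axis a 1" using Omega_axis[OF u s] by blast
      obtain b where b: "v s = axis b 1" using Omega_axis[OF v s] by blast
      let ?e1 = "l (y s) - l (x s) - Dl (x s) (?h s)"
      let ?e2 = "f b (y s) - f b (x s) - Df b (x s) (?h s)"
      let ?e3 = "Df b (x s) (?h s) - Df a (x s) (?h s)"
      have eq: "?res s = ?e1 + \<rho> s \<bullet> ?e2 + \<rho> s \<bullet> ?e3"
        unfolding a b F_axis Hin by (simp add: inner_diff_right)
      have hr: "norm (?h s) \<le> r" using r s by blast
      have h2: "norm (?h s) ^ 2 \<le> r\<^sup>2" using hr by (intro power_mono) auto
      have P': "\<bar>\<rho> s \<bullet> z\<bar> \<le> P * norm z" for z
        using Cauchy_Schwarz_ineq2[of "\<rho> s" z] P(2) s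
        by (meson mult_right_mono norm_ge_zero order_trans)
      have 1: "\<bar>?e1\<bar> \<le> K' * r\<^sup>2"
        using el[rule_format, of "y s" "x s"] mult_left_mono[OF h2 K'] by simp
      have "norm ?e2 \<le> K * r\<^sup>2"
        using ef[of b "y s" "x s"] mult_left_mono[OF h2 K] by simp
      then have 2: "\<bar>\<rho> s \<bullet> ?e2\<bar> \<le> P * (K * r\<^sup>2)"
        using P'[of ?e2] P(1) mult_left_mono[of "norm ?e2" "K * r\<^sup>2" P] by linarith
      have 3: "\<bar>\<rho> s \<bullet> ?e3\<bar> \<le> (2 * P * D * r) * ?\<chi> s"
      proof (cases "u s = v s")
        case True
        then have "axis a (1::real) = axis b 1" using a b by metis
        then have "a = b" by (simp add: axis_eq_axis)
        then show ?thesis using True by simp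
      next
        case False
        have "norm (Df c (x s) (?h s)) \<le> D * r" for c
          using norm_blinfun[of "Df c (x s)" "?h s"] mult_mono[OF D(2)[OF s, of c] hr] D(1) by simp
        then have "norm ?e3 \<le> 2 * (D * r)"
          using norm_triangle_ineq4[of "Df b (x s) (?h s)" "Df a (x s) (?h s)"]
          by (smt (verit))
        then have "\<bar>\<rho> s \<bullet> ?e3\<bar> \<le> P * (2 * (D * r))"
          using P'[of ?e3] P(1) mult_left_mono[of "norm ?e3" "2 * (D * r)" P] by linarith
        then show ?thesis using False by simp
      qed
      have "norm (?res s) \<le> \<bar>?e1\<bar> + \<bar>\<rho> s \<bullet> ?e2\<bar> + \<bar>\<rho> s \<bullet> ?e3\<bar>"
        unfolding eq real_norm_def by linarith
      then show "norm (?res s) \<le> (K' + P * K) * r\<^sup>2 + (2 * P * D * r) * ?\<chi> s"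
        using 1 2 3 by (simp only: distrib_right mult.assoc)
    qed
    also have "\<dots> = T * (K' + P * K) * r\<^sup>2 + 2 * P * D * r * mismatch T u v"
    proof -
      have "((\<lambda>s. (K' + P * K) * r\<^sup>2 + (2 * P * D * r) * ?\<chi> s) has_integral
        ((T - 0) *\<^sub>R ((K' + P * K) * r\<^sup>2) + (2 * P * D * r) * mismatch T u v)) {0..T}"
        using i\<chi> T by (intro has_integral_add has_integral_mult_right has_integral_const_real[THEN back_subst[where P = "\<lambda>i. (_ has_integral i) _"]])
          (auto simp: has_integral_iff)
      then show ?thesis by (simp add: has_integral_iff)
    qed
    also have "\<dots> \<le> M * (r\<^sup>2 + r * mismatch T u v)"
    proof -
      have "0 \<le> T * (K' + P * K) * (r * mismatch T u v)" "0 \<le> 2 * P * D * r\<^sup>2"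
        using T K K' P D r0 i\<chi>(3) by simp_all
      then show ?thesis unfolding M_def by (simp add: algebra_simps)
    qed
    finally show ?thesis using res by (simp add: has_integral_iff)
  qed
  then show ?thesis using M by blast
qed

section \<open>The projected control\<close>

text \<open>
  Counting critical points to the left is injective on the non-critical points of a level set: between
  two such points with the same count there would be no critical point, against Rolle's theorem.
\<close>
lemma finite_level_set:
  assumes fin: "finite (critical_points T g)"
  shows "finite {t \<in> {0..T}. g t = c}"
proof -
  let ?C = "critical_points T g"
  let ?Z = "{t \<in> {0..T}. g t = c} - ?C"
  define \<kappa> where "\<kappa> = (\<lambda>t. card {s \<in> ?C. s < t})"
  have ne: "\<kappa> z \<noteq> \<kappa> z'" if z: "z \<in> ?Z" and z': "z' \<in> ?Z" and lt: "z < z'" for z z'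
  proof
    assume eq: "\<kappa> z = \<kappa> z'"
    have same: "{s \<in> ?C. s < z} = {s \<in> ?C. s < z'}"
      by (rule card_subset_eq) (use fin lt eq in \<open>auto simp: \<kappa>_def\<close>)
    have no: "s \<notin> ?C" if "s \<in> {z..z'}" for s
    proof
      assume s: "s \<in> ?C"
      then have "s \<noteq> z'" using z' by auto
      then have "s \<in> {s \<in> ?C. s < z'}" using s that by simp
      then have "s \<in> {s \<in> ?C. s < z}" by (simp only: same)
      then show False using that by simp
    qed
    have sub: "{z..z'} \<subseteq> {0..T}" using z z' by auto
    have diff: "g differentiable (at s within {0..T})"
      and nz: "\<not> (g has_real_derivative 0) (at s within {0..T})" if "s \<in> {z..z'}" for s
      using no[OF that] sub that unfolding critical_points_def by blast+
    have "\<exists>w. z < w \<and> w < z' \<and> DERIV g w :> 0"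
    proof (rule Rolle[OF lt])
      show "g z = g z'" using z z' by simp
      show "continuous_on {z..z'} g"
        unfolding continuous_on_eq_continuous_within
        using diff sub by (blast intro: continuous_within_subset differentiable_imp_continuous_within)
      show "g differentiable (at s)" if "z < s" "s < z'" for s
        using diff[of s] that sub z z' at_within_Icc_at[of 0 s T] by auto
    qed
    then obtain w where "z < w" "w < z'" "DERIV g w :> 0" by blast
    then show False using nz[of w] has_field_derivative_at_within by auto
  qed
  have "inj_on \<kappa> ?Z"
    by (rule linorder_inj_onI) (use ne in auto)
  moreover have "\<kappa> ` ?Z \<subseteq> {..card ?C}"
    using fin by (auto simp: \<kappa>_def intro: card_mono)
  ultimately have "finite ?Z" using finite_imageD finite_subset by blast
  then have "finite (?Z \<union> ?C)" using fin by blast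
  then show ?thesis by (rule rev_finite_subset) blast
qed

lemma Q_strict_max:
  assumes "\<And>c. c \<noteq> a \<Longrightarrow> \<mu> t $ c < \<mu> t $ a"
  shows "\<Q> \<mu> t = axis a 1"
proof -
  have "\<Q> \<mu> t $ i = axis a 1 $ i" for i
  proof (cases "i = a")
    case True
    have "(\<Prod>j\<in>UNIV - {a}. step (\<mu> t $ a - \<mu> t $ j)) = 1"
      by (rule prod.neutral) (use assms in \<open>force simp: step_def\<close>)
    then show ?thesis using True by (simp add: \<Q>_def)
  next
    case False
    have "(\<Prod>j\<in>UNIV - {i}. step (\<mu> t $ i - \<mu> t $ j)) = 0"
      by (rule prod_zero) (use False assms[of i] in \<open>auto intro!: bexI[of _ a] simp: step_def\<close>)
    then show ?thesis using False by (simp add: \<Q>_def axis_def)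
  qed
  then show ?thesis by (simp add: vec_eq_iff)
qed

lemma Q_unit_vector:
  assumes "\<mu> t = axis a 1"
  shows "\<Q> \<mu> t = axis a 1"
  by (rule Q_strict_max) (simp add: assms axis_def)

text \<open>
  The components of \<open>u - \<gamma> d\<close> can be tied only where some \<open>d\<^sub>i - d\<^sub>j\<close> equals \<open>-1/\<gamma>\<close>, \<open>0\<close> or \<open>1/\<gamma>\<close>, which
  are finitely many times. Elsewhere the maximal component is strict, hence locally constant by
  continuity. The active component equals \<open>1\<close> because \<open>d\<close> vanishes there, and mode \<open>a\<close> beats it exactly
  if \<open>-\<gamma> d\<^sub>a > 1\<close>.
\<close>
lemma Q_line_locally_constant:
  fixes u d :: "real \<Rightarrow> real ^ 'm::finite"
  assumes g: "\<gamma> > 0" and u: "piecewise_mode T C u"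
    and cont: "\<And>t a. t \<in> {0<..<T} - C \<Longrightarrow> isCont (\<lambda>s. d s $ a) t"
    and act: "\<And>t b. t \<in> {0..T} \<Longrightarrow> u t = axis b 1 \<Longrightarrow> d t $ b = 0"
    and lev: "\<And>i j c. i \<noteq> j \<Longrightarrow> finite {t \<in> {0..T}. d t $ i - d t $ j = c}"
  shows "\<exists>D. piecewise_mode T D (\<Q> (line u d \<gamma>)) \<and> (\<forall>t\<in>{0<..<T} - D. \<exists>a b.
    u t = axis b 1 \<and> \<Q> (line u d \<gamma>) t = axis a 1 \<and>
    (if a = b then \<forall>c. - 1 / \<gamma> \<le> d t $ c else d t $ a < - 1 / \<gamma>))"
proof -
  let ?w = "\<Q> (line u d \<gamma>)"
  define tie where "tie = (\<lambda>i j. \<Union>k\<in>{-1, 0, 1}. {t \<in> {0..T}. d t $ i - d t $ j = k / \<gamma>})"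
  define ties where "ties = (\<Union>i. \<Union>j\<in>- {i}. tie i j)"
  define D where "D = C \<union> ties"
  have "finite (tie i j)" if "i \<noteq> j" for i j
    unfolding tie_def by (intro finite_UN_I lev that) auto
  then have "finite ties" unfolding ties_def by (intro finite_UN_I) auto
  then have fin: "finite D" using u unfolding piecewise_mode_def D_def by blast
  have loc: "\<exists>a b. u t = axis b 1 \<and> (\<forall>\<^sub>F s in nhds t. ?w s = axis a 1) \<and>
    (if a = b then \<forall>c. - 1 / \<gamma> \<le> d t $ c else d t $ a < - 1 / \<gamma>)" if t: "t \<in> {0<..<T} - D" for t
  proof -
    have tC: "t \<in> {0<..<T} - C" and tT: "t \<in> {0..T}" using t by (auto simp: D_def)
    let ?\<mu> = "\<lambda>s i. line u d \<gamma> s $ i"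
    obtain b where b: "\<forall>\<^sub>F s in nhds t. u s = axis b 1"
      using u tC unfolding piecewise_mode_def by blast
    have ub: "u t = axis b 1" by (rule eventually_nhds_x_imp_x[OF b])
    have db: "d t $ b = 0" by (rule act[OF tT ub])
    have ne: "?\<mu> t i \<noteq> ?\<mu> t j" if ij: "i \<noteq> j" for i j
    proof
      assume eq: "?\<mu> t i = ?\<mu> t j"
      define k where "k = axis b (1::real) $ i - axis b 1 $ j"
      have k: "k \<in> {-1, 0, 1}" by (auto simp: k_def axis_def)
      have "d t $ i - d t $ j = k / \<gamma>"
        using eq g by (simp add: line_def ub k_def field_simps)
      then have "t \<in> tie i j" unfolding tie_def using k tT by (intro UN_I[of k]) simp_all
      then have "t \<in> (\<Union>j\<in>- {i}. tie i j)" using ij by (intro UN_I[of j]) simp_all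
      then have "t \<in> ties" unfolding ties_def by (rule UN_I[OF UNIV_I])
      then show False using t by (simp add: D_def)
    qed
    have "Max (range (?\<mu> t)) \<in> range (?\<mu> t)" by (rule Max_in) auto
    then obtain a where "Max (range (?\<mu> t)) = ?\<mu> t a" by (rule rangeE)
    then have "?\<mu> t c \<le> ?\<mu> t a" for c using Max_ge[of "range (?\<mu> t)" "?\<mu> t c"] by simp
    then have a: "?\<mu> t c < ?\<mu> t a" if "c \<noteq> a" for c
      using ne[OF that] by (simp add: order_less_le)
    have cm: "isCont (\<lambda>s. ?\<mu> s i) t" for i
    proof -
      have "isCont (\<lambda>s. u s $ i) t"
        by (rule piecewise_mode_isCont[OF u tC, where H = "\<lambda>s w. w $ i"]) simp
      then have "isCont (\<lambda>s. u s $ i - \<gamma> * d s $ i) t"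
        by (rule continuous_diff) (rule continuous_mult[OF continuous_const cont[OF tC]])
      then show ?thesis by (simp add: line_def)
    qed
    have "\<forall>\<^sub>F s in nhds t. ?\<mu> s c < ?\<mu> s a" if c: "c \<noteq> a" for c
    proof -
      have "isCont (\<lambda>s. ?\<mu> s a - ?\<mu> s c) t" by (intro continuous_intros cm)
      then have "((\<lambda>s. ?\<mu> s a - ?\<mu> s c) \<longlongrightarrow> ?\<mu> t a - ?\<mu> t c) (nhds t)"
        by (simp add: isCont_def tendsto_nhds_iff)
      then have "\<forall>\<^sub>F s in nhds t. 0 < ?\<mu> s a - ?\<mu> s c"
        by (rule order_tendstoD(1)) (use a[OF c] in simp)
      then show ?thesis by (rule eventually_mono) simp
    qed
    then have "\<forall>\<^sub>F s in nhds t. \<forall>c\<in>- {a}. ?\<mu> s c < ?\<mu> s a"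
      by (intro eventually_ball_finite) auto
    then have "\<forall>\<^sub>F s in nhds t. ?w s = axis a 1"
      by (rule eventually_mono) (rule Q_strict_max, simp)
    moreover have "if a = b then \<forall>c. - 1 / \<gamma> \<le> d t $ c else d t $ a < - 1 / \<gamma>"
    proof (cases "a = b")
      case True
      have "- 1 / \<gamma> \<le> d t $ c" for c
      proof (cases "c = b")
        case False
        then show ?thesis using a[of c] True g db by (simp add: line_def ub axis_def field_simps)
      qed (use db g in simp)
      then show ?thesis using True by simp
    next
      case False
      then show ?thesis using a[of b] g db by (simp add: line_def ub axis_def field_simps)
    qed
    ultimately show ?thesis using ub by blast
  qed
  have "piecewise_mode T D ?w"
    unfolding piecewise_mode_def using fin loc by blast
  moreover have "\<exists>a b. u t = axis b 1 \<and> ?w t = axis a 1 \<and>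
    (if a = b then \<forall>c. - 1 / \<gamma> \<le> d t $ c else d t $ a < - 1 / \<gamma>)" if "t \<in> {0<..<T} - D" for t
    using loc[OF that] eventually_nhds_x_imp_x by fast
  ultimately show ?thesis by blast
qed

lemma ae_eq_iff_negligible: "ae_eq T g h \<longleftrightarrow> negligible {t \<in> {0..T}. g t \<noteq> h t}"
proof
  assume "ae_eq T g h"
  then obtain N where "{t \<in> space lebesgue. \<not> (t \<in> {0..T} \<longrightarrow> g t = h t)} \<subseteq> N"
    "emeasure lebesgue N = 0" "N \<in> sets lebesgue"
    unfolding ae_eq_def by (rule AE_E)
  then have "{t \<in> {0..T}. g t \<noteq> h t} \<subseteq> N" "negligible N"
    by (auto simp: negligible_iff_null_sets)
  then show "negligible {t \<in> {0..T}. g t \<noteq> h t}" by (rule negligible_subset[rotated])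
next
  assume "negligible {t \<in> {0..T}. g t \<noteq> h t}"
  then show "ae_eq T g h"
    unfolding ae_eq_def negligible_iff_null_sets by (rule AE_I') auto
qed

lemma ae_eq_sym: "ae_eq T g h \<Longrightarrow> ae_eq T h g"
  unfolding ae_eq_iff_negligible by (erule negligible_subset) auto

lemma ae_eq_trans: "ae_eq T g h \<Longrightarrow> ae_eq T h k \<Longrightarrow> ae_eq T g k"
  unfolding ae_eq_iff_negligible
  by (rule negligible_subset[of "{t \<in> {0..T}. g t \<noteq> h t} \<union> {t \<in> {0..T}. h t \<noteq> k t}"])
    (simp, auto)

lemma mismatch_ae_eq: "ae_eq T u v \<Longrightarrow> mismatch T u v = 0"
proof -
  assume "ae_eq T u v"
  then have "integral {0..T} (\<lambda>t. if u t = v t then 0 else 1 :: real) = integral {0..T} (\<lambda>t. 0)"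
    unfolding ae_eq_iff_negligible by (rule integral_spike) auto
  then show ?thesis unfolding mismatch_def by simp
qed

lemma S_iff:
  assumes "T > 0"
  shows "(x, u) \<in> \<S> f x0 T \<longleftrightarrow> u \<in> \<Omega> T \<and> trajectory f x0 T x u"
proof -
  have "x \<in> L1 T" if "trajectory f x0 T x u"
    using trajectory_continuous(1)[OF that] assms
    by (simp add: L1_def absolutely_integrable_continuous_real)
  then show ?thesis using Omega_integrable unfolding \<S>_def trajectory_def by blast
qed

text \<open>
  The choice in \<^const>\<open>\<P>\<close> is meaningful once some element of \<^const>\<open>\<S>\<close> has the projected control.
\<close>
lemma P_spec:
  assumes "(y, v) \<in> \<S> f x0 T" "ae_eq T v (\<Q> \<mu>)"
  obtains y' v' where "\<P> f x0 T \<alpha> \<mu> = (y', v')" "(y', v') \<in> \<S> f x0 T" "ae_eq T v' (\<Q> \<mu>)"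
proof -
  have "\<exists>\<xi>. case \<xi> of (y, v) \<Rightarrow> (y, v) \<in> \<S> f x0 T \<and> ae_eq T v (\<Q> \<mu>)" using assms by auto
  then have "case \<P> f x0 T \<alpha> \<mu> of (y, v) \<Rightarrow> (y, v) \<in> \<S> f x0 T \<and> ae_eq T v (\<Q> \<mu>)"
    unfolding \<P>_def by (rule someI_ex)
  then show ?thesis using that by (cases "\<P> f x0 T \<alpha> \<mu>") auto
qed

section \<open>Length of the switched set\<close>

lemma closed_subinterval:
  fixes p q :: real
  assumes "p < q"
  shows "\<exists>p' q'. p < p' \<and> p' < q' \<and> q' < q"
  using dense[OF assms] dense by metis

text \<open>
  On the side of \<open>t\<close> on which the control keeps its value, \<open>H s (u s)\<close> agrees with the continuous
  function \<open>H s (u t)\<close>. That side is the right one, except at \<open>T\<close>.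
\<close>
lemma strict_inequality_persists:
  fixes H :: "real \<Rightarrow> real ^ 'm::finite \<Rightarrow> real"
  assumes u: "u \<in> \<Omega> T" and t: "t \<in> {0..T}"
    and H: "continuous_on {0..T} (\<lambda>s. H s (u t))" and less: "H t (u t) < \<kappa>"
  shows "\<exists>p q. p < q \<and> {p..q} \<subseteq> {0..T} \<and> (\<forall>s\<in>{p..q}. H s (u s) < \<kappa>)"
proof (cases "t < T")
  case True
  have "continuous_on {t..T} (\<lambda>s. H s (u t))" by (rule continuous_on_subset[OF H]) (use t in auto)
  then have "((\<lambda>s. H s (u t)) \<longlongrightarrow> H t (u t)) (at_right t)"
    using True by (rule continuous_on_Icc_at_rightD)
  then have "\<forall>\<^sub>F s in at_right t. H s (u t) < \<kappa>" by (rule order_tendstoD(2)[OF _ less])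
  moreover have "\<forall>\<^sub>F s in at_right t. u s = u t" by (rule Omega_right[OF u]) (use t True in simp)
  ultimately have "\<forall>\<^sub>F s in at_right t. H s (u s) < \<kappa>" by eventually_elim simp
  then obtain r where r: "t < r" "\<forall>s>t. s < r \<longrightarrow> H s (u s) < \<kappa>"
    unfolding eventually_at_right_field by blast
  have "t < min r T" using r True by simp
  then obtain p q where "t < p" "p < q" "q < min r T" using closed_subinterval by blast
  then have "p < q \<and> {p..q} \<subseteq> {0..T} \<and> (\<forall>s\<in>{p..q}. H s (u s) < \<kappa>)" using r t by auto
  then show ?thesis by blast
next
  case False
  have tT: "t = T" and T: "0 < T" using False t Omega_cases[OF u] by auto
  have "((\<lambda>s. H s (u t)) \<longlongrightarrow> H T (u t)) (at_left T)"
    using H T by (rule continuous_on_Icc_at_leftD)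
  then have "\<forall>\<^sub>F s in at_left T. H s (u t) < \<kappa>"
    by (rule order_tendstoD(2)) (use less tT in simp)
  moreover have "\<forall>\<^sub>F s in at_left T. u s = u T" by (rule Omega_left[OF u])
  ultimately have "\<forall>\<^sub>F s in at_left T. H s (u s) < \<kappa>" unfolding tT by eventually_elim simp
  then obtain r where r: "r < T" "\<forall>s>r. s < T \<longrightarrow> H s (u s) < \<kappa>"
    unfolding eventually_at_left_field by blast
  have "max r 0 < T" using r T by simp
  then obtain p q where "max r 0 < p" "p < q" "q < T" using closed_subinterval by blast
  then have "p < q \<and> {p..q} \<subseteq> {0..T} \<and> (\<forall>s\<in>{p..q}. H s (u s) < \<kappa>)" using r by auto
  then show ?thesis by blast
qed

text \<open>
  Dominated convergence along a sequence decreasing to \<open>- 1 / \<theta>'\<close>, followed by monotonicity in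
  \<open>\<gamma>\<close>: the sublevel sets shrink to the null set where the lower bound \<open>\<theta>'\<close> is attained.
\<close>
lemma sublevel_indicator_vanishes:
  fixes d :: "real \<Rightarrow> real ^ 'm::finite"
  assumes th: "\<theta>' < 0" and low: "\<And>t c. t \<in> {0..T} \<Longrightarrow> \<theta>' \<le> d t $ c"
    and neg: "negligible {t \<in> {0..T}. \<exists>c. d t $ c = \<theta>'}"
    and int: "\<And>\<gamma>. \<gamma> > 0 \<Longrightarrow> (\<lambda>t. if \<exists>c. d t $ c < - 1 / \<gamma> then 1 else 0 :: real) integrable_on {0..T}"
    and e: "e > 0"
  shows "\<exists>\<delta>>0. \<forall>\<gamma>\<in>{- 1 / \<theta>' <..< - 1 / \<theta>' + \<delta>}.
    integral {0..T} (\<lambda>t. if \<exists>c. d t $ c < - 1 / \<gamma> then 1 else 0 :: real) < e"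
proof -
  let ?I = "\<lambda>\<gamma> t. if \<exists>c. d t $ c < - 1 / \<gamma> then 1 else 0 :: real"
  let ?L = "\<lambda>t. if \<exists>c. d t $ c = \<theta>' then 1 else 0 :: real"
  define g0 where "g0 = - 1 / \<theta>'"
  have g0: "g0 > 0" and th0: "\<theta>' = - 1 / g0" using th by (simp_all add: g0_def field_simps)
  define G where "G = (\<lambda>n. g0 + inverse (real (Suc n)))"
  have Gpos: "G n > g0" for n by (simp add: G_def)
  have Glim: "G \<longlonglongrightarrow> g0" unfolding G_def
    using tendsto_add[OF tendsto_const LIMSEQ_inverse_real_of_nat, of g0] by simp
  have Glim': "(\<lambda>n. - 1 / G n) \<longlonglongrightarrow> \<theta>'"
    unfolding th0 using Glim g0 by (intro tendsto_intros) auto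
  have Gth: "\<theta>' < - 1 / G n" for n
    unfolding th0 using Gpos[of n] g0 by (simp add: field_simps)
  have "(\<lambda>n. integral {0..T} (?I (G n))) \<longlonglongrightarrow> integral {0..T} ?L"
  proof (rule dominated_convergence(2)[where h = "\<lambda>_. 1"])
    show "?I (G n) integrable_on {0..T}" for n
      using int[of "G n"] Gpos[of n] g0 by simp
    show "(\<lambda>n. ?I (G n) t) \<longlonglongrightarrow> ?L t" if t: "t \<in> {0..T}" for t
    proof (cases "\<exists>c. d t $ c = \<theta>'")
      case True
      then have "?I (G n) t = 1" for n using Gth[of n] by metis
      then show ?thesis using True by simp
    next
      case False
      then have "\<theta>' < d t $ c" for c using low[OF t, of c] by (metis order_less_le)
      then have "\<forall>c\<in>UNIV. \<forall>\<^sub>F n in sequentially. - 1 / G n < d t $ c"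
        using order_tendstoD(2)[OF Glim'] by blast
      then have "\<forall>\<^sub>F n in sequentially. \<forall>c\<in>UNIV. - 1 / G n < d t $ c"
        by (intro eventually_ball_finite) auto
      then have "\<forall>\<^sub>F n in sequentially. ?I (G n) t = 0"
        by (rule eventually_mono) (auto simp: not_less intro: less_imp_le)
      then show ?thesis using False by (simp add: tendsto_eventually)
    qed
  qed auto
  moreover have "integral {0..T} ?L = integral {0..T} (\<lambda>_. 0)"
    by (rule integral_spike[OF neg]) auto
  ultimately have "(\<lambda>n. integral {0..T} (?I (G n))) \<longlonglongrightarrow> 0" by simp
  then have "\<forall>\<^sub>F n in sequentially. integral {0..T} (?I (G n)) < e"
    using e by (rule order_tendstoD(2))
  then obtain n where n: "integral {0..T} (?I (G n)) < e"
    by (auto simp: eventually_sequentially)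
  have "integral {0..T} (?I \<gamma>) < e" if "\<gamma> \<in> {g0 <..< G n}" for \<gamma>
  proof -
    have gp: "0 < \<gamma>" "\<gamma> < G n" using that g0 by auto
    then have le: "- 1 / \<gamma> \<le> - 1 / G n" by (simp add: field_simps)
    have "integral {0..T} (?I \<gamma>) \<le> integral {0..T} (?I (G n))"
    proof (rule integral_le)
      show "?I \<gamma> integrable_on {0..T}" "?I (G n) integrable_on {0..T}"
        using int[of \<gamma>] int[of "G n"] gp by simp_all
      show "?I \<gamma> t \<le> ?I (G n) t" for t
      proof (cases "\<exists>c. d t $ c < - 1 / \<gamma>")
        case True
        then have "\<exists>c. d t $ c < - 1 / G n" using less_le_trans[OF _ le] by blast
        then show ?thesis by simp
      qed simp
    qed
    then show ?thesis using n by simp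
  qed
  then show ?thesis unfolding g0_def[symmetric] G_def
    by (intro exI[of _ "inverse (real (Suc n))"]) simp
qed

section \<open>The descent property\<close>

theorem corollary2:
  fixes f :: "'m::finite \<Rightarrow> real ^ 'n::finite \<Rightarrow> real ^ 'n"
    and l :: "real ^ 'n \<Rightarrow> real"
    and x0 :: "real ^ 'n"
    and T K2 K2' :: real
    and x \<rho> :: "real \<Rightarrow> real ^ 'n"
    and u d :: "real \<Rightarrow> real ^ 'm"
  assumes "T > 0"
    and "\<And>i. C2_bounded K2 (f i)"
    and "C2_bounded K2' l"
    and "(x, u) \<in> \<S> f x0 T"
    and "adjoint_solution f l T x u \<rho>"
    and "d = mode_insertion_gradient f x u \<rho>"
    and "piecewise_continuous T d"
    and "\<And>i j. i \<noteq> j \<Longrightarrow> finite (critical_points T (\<lambda>t. d t $ i - d t $ j))"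
    and "\<theta> T d < 0"
    and "max_type T u d = 1 \<or> max_type T u d = 2"
  shows "\<exists>\<delta>>0. \<forall>\<gamma>\<in>{\<gamma>\<^sub>0 T d <..< \<gamma>\<^sub>0 T d + \<delta>}.
           J l T (\<P> f x0 T x (line u d \<gamma>)) < J l T (\<P> f x0 T x (line u d 0))"
proof -
  note T = assms(1) and f = assms(2) and l = assms(3)
  have u: "u \<in> \<Omega> T" and x: "trajectory f x0 T x u" using assms(4) S_iff[OF T] by blast+
  have cx: "continuous_on {0..T} x" using trajectory_continuous(1)[OF x] T by simp
  have c\<rho>: "continuous_on {0..T} \<rho>"
    by (rule primitive_continuous[OF adjoint_solution_primitive[OF assms(5)]])
  have cf: "continuous_on {0..T} (\<lambda>t. f a (x t))" for a
    by (rule continuous_on_compose2[OF C2_bounded_continuous[OF f, of UNIV] cx]) simp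
  \<comment> \<open>\<open>H a s w\<close> is \<open>d\<^sub>a(s)\<close> as it would be if the control had the value \<open>w\<close> at time \<open>s\<close>.\<close>
  define H where "H = (\<lambda>a s w. \<rho> s \<bullet> (f a (x s) - F f (x s) w))"
  have d: "d t $ a = H a t (u t)" for t a
    by (simp add: assms(6) mode_insertion_gradient_def H_def)
  have cH: "continuous_on {0..T} (\<lambda>s. H a s (axis b 1))" for a b
    unfolding H_def F_axis by (intro continuous_intros c\<rho> cf)
  obtain C where C: "piecewise_mode T C u" using Omega_piecewise[OF u] by blast
  have dcont: "isCont (\<lambda>s. d s $ a) t" if t: "t \<in> {0<..<T} - C" for t a
    unfolding d
  proof (rule piecewise_mode_isCont[OF C t, where H = "H a"])
    show "isCont (\<lambda>s. H a s (axis b 1)) t" for b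
      using continuous_on_interior[OF cH, of t] t by simp
  qed
  have act: "d t $ b = 0" if "u t = axis b 1" for t b
    by (simp add: d H_def that F_axis)
  have lev: "finite {t \<in> {0..T}. d t $ i - d t $ j = c}" if "i \<noteq> j" for i j c
    by (rule finite_level_set[OF assms(8)[OF that]])

  have proj: "\<exists>v\<in>\<Omega> T. ae_eq T v (\<Q> (line u d \<gamma>))"
    and switched: "\<And>v. ae_eq T v (\<Q> (line u d \<gamma>)) \<Longrightarrow> \<exists>N. negligible N \<and> (\<forall>t\<in>{0..T} - N. \<exists>a b.
      u t = axis b 1 \<and> v t = axis a 1 \<and>
      (if a = b then \<forall>c. - 1 / \<gamma> \<le> d t $ c else d t $ a < - 1 / \<gamma>))"
    if g: "\<gamma> > 0" for \<gamma>
  proof -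
    obtain D where D: "piecewise_mode T D (\<Q> (line u d \<gamma>))"
      and sw: "\<forall>t\<in>{0<..<T} - D. \<exists>a b. u t = axis b 1 \<and> \<Q> (line u d \<gamma>) t = axis a 1 \<and>
        (if a = b then \<forall>c. - 1 / \<gamma> \<le> d t $ c else d t $ a < - 1 / \<gamma>)"
      using Q_line_locally_constant[OF g C dcont act lev] by blast
    show "\<exists>v\<in>\<Omega> T. ae_eq T v (\<Q> (line u d \<gamma>))" by (rule Omega_representative[OF D T])
    fix v assume "ae_eq T v (\<Q> (line u d \<gamma>))"
    then have neg: "negligible {t \<in> {0..T}. v t \<noteq> \<Q> (line u d \<gamma>) t}" (is "negligible ?A")
      unfolding ae_eq_iff_negligible .
    have "finite (D \<union> {0, T})" using D unfolding piecewise_mode_def by blast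
    then have "negligible (?A \<union> (D \<union> {0, T}))" by (intro negligible_Un neg negligible_finite)
    moreover have "\<exists>a b. u t = axis b 1 \<and> v t = axis a 1 \<and>
      (if a = b then \<forall>c. - 1 / \<gamma> \<le> d t $ c else d t $ a < - 1 / \<gamma>)"
      if t: "t \<in> {0..T} - (?A \<union> (D \<union> {0, T}))" for t
    proof -
      have "v t = \<Q> (line u d \<gamma>) t" "t \<in> {0<..<T} - D" using t by auto
      then show ?thesis using sw by simp
    qed
    ultimately show "\<exists>N. negligible N \<and> (\<forall>t\<in>{0..T} - N. \<exists>a b.
      u t = axis b 1 \<and> v t = axis a 1 \<and>
      (if a = b then \<forall>c. - 1 / \<gamma> \<le> d t $ c else d t $ a < - 1 / \<gamma>))" by blast
  qed

  let ?I = "\<lambda>\<gamma> t. if \<exists>c. d t $ c < - 1 / \<gamma> then 1 else 0 :: real"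
  let ?F = "\<lambda>v t. \<rho> t \<bullet> (F f (x t) (v t) - F f (x t) (u t))"
  have iF: "(\<lambda>t. \<rho> t \<bullet> F f (x t) (z t)) integrable_on {0..T}" if "z \<in> \<Omega> T" for z
    by (rule set_lebesgue_integral_eq_integral(1),
        rule integrable_controlled[OF that, where H = "\<lambda>t w. \<rho> t \<bullet> F f (x t) w"])
      (unfold F_axis, intro continuous_intros c\<rho> cf)
  \<comment> \<open>Off a null set, \<open>v\<close> differs from \<open>u\<close> exactly on the sublevel set, and the integrand of the
    first-order term is \<open>d\<^sub>a\<close> for the selected mode \<open>a\<close>.\<close>
  have first_order: "?I \<gamma> integrable_on {0..T}" "mismatch T u v = integral {0..T} (?I \<gamma>)"
    "integral {0..T} (?F v) \<le> - 1 / \<gamma> * mismatch T u v"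
    if g: "\<gamma> > 0" and v: "v \<in> \<Omega> T" and ae: "ae_eq T v (\<Q> (line u d \<gamma>))" for \<gamma> v
  proof -
    let ?\<chi> = "\<lambda>t. if u t = v t then 0 else 1 :: real"
    obtain N where N: "negligible N" and sw: "\<forall>t\<in>{0..T} - N. \<exists>a b.
      u t = axis b 1 \<and> v t = axis a 1 \<and>
      (if a = b then \<forall>c. - 1 / \<gamma> \<le> d t $ c else d t $ a < - 1 / \<gamma>)"
      using switched[OF g ae] by blast
    have pt: "?I \<gamma> t = ?\<chi> t \<and> ?F v t \<le> - 1 / \<gamma> * ?\<chi> t" if t: "t \<in> {0..T} - N" for t
    proof -
      obtain a b where ab: "u t = axis b 1" "v t = axis a 1"
        "if a = b then \<forall>c. - 1 / \<gamma> \<le> d t $ c else d t $ a < - 1 / \<gamma>" using sw t by blast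
      have Fd: "?F v t = d t $ a" by (simp add: d H_def ab(2) F_axis)
      show ?thesis
      proof (cases "a = b")
        case True
        then have "\<not> (\<exists>c. d t $ c < - 1 / \<gamma>)" using ab(3) by (simp add: not_less)
        moreover have "u t = v t" using ab True by simp
        moreover have "?F v t = 0" using calculation(2) by simp
        ultimately show ?thesis by simp
      next
        case False
        then have "u t \<noteq> v t" using ab by (simp add: axis_eq_axis)
        moreover have less: "d t $ a < - 1 / \<gamma>" using ab(3) False by simp
        moreover have "\<exists>c. d t $ c < - 1 / \<gamma>" using less by blast
        ultimately show ?thesis unfolding Fd by simp
      qed
    qed
    have i\<chi>: "?\<chi> integrable_on {0..T}" using mismatch_indicator_integral(1)[OF u v, of T] T by simp
    show "?I \<gamma> integrable_on {0..T}" by (rule integrable_spike[OF i\<chi> N]) (use pt in blast)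
    show "mismatch T u v = integral {0..T} (?I \<gamma>)"
      unfolding mismatch_def by (rule integral_spike[OF N]) (use pt in blast)
    let ?G = "\<lambda>t. if t \<in> N then - 1 / \<gamma> * ?\<chi> t else ?F v t"
    have iFv: "?F v integrable_on {0..T}"
      unfolding inner_diff_right by (intro integrable_diff iF u v)
    have "integral {0..T} (?F v) = integral {0..T} ?G"
      by (rule integral_spike[OF N]) simp
    also have "\<dots> \<le> integral {0..T} (\<lambda>t. - 1 / \<gamma> * ?\<chi> t)"
    proof (rule integral_le)
      show "?G integrable_on {0..T}" by (rule integrable_spike[OF iFv N]) simp
      show "(\<lambda>t. - 1 / \<gamma> * ?\<chi> t) integrable_on {0..T}" by (rule integrable_on_mult_right[OF i\<chi>])
      show "?G t \<le> - 1 / \<gamma> * ?\<chi> t" if "t \<in> {0..T}" for t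
        using pt[of t] that by (cases "t \<in> N") simp_all
    qed
    also have "\<dots> = - 1 / \<gamma> * mismatch T u v" unfolding mismatch_def by (rule integral_mult_right)
    finally show "integral {0..T} (?F v) \<le> - 1 / \<gamma> * mismatch T u v" .
  qed

  obtain P where P: "P > 0" "\<forall>t\<in>{0..T}. norm (\<rho> t) \<le> P"
    by (rule continuous_on_Icc_bound[OF c\<rho>])
  obtain B where B: "B > 0" "\<And>a t. t \<in> {0..T} \<Longrightarrow> norm (f a (x t)) \<le> B"
    using finite_family_bound[of T "\<lambda>a t. f a (x t)", OF cf] by blast
  have dlow: "- (P * (2 * B)) \<le> d t $ a" if t: "t \<in> {0..T}" for t a
  proof -
    obtain b where b: "u t = axis b 1" using Omega_axis[OF u t] by blast
    have "\<bar>d t $ a\<bar> \<le> norm (\<rho> t) * norm (f a (x t) - f b (x t))"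
      unfolding d H_def b F_axis by (rule Cauchy_Schwarz_ineq2)
    also have "\<dots> \<le> P * (2 * B)"
      using P B(1) B(2)[OF t, of a] B(2)[OF t, of b] t norm_triangle_ineq4[of "f a (x t)" "f b (x t)"]
      by (intro mult_mono) auto
    finally show ?thesis by simp
  qed
  have low: "\<theta> T d \<le> d t $ c" if t: "t \<in> {0..T}" for t c
  proof -
    have "bdd_below ((\<lambda>(\<sigma>, t). d t $ \<sigma>) ` (UNIV \<times> {0..T}))"
      using dlow by (intro bdd_belowI[of _ "- (P * (2 * B))"]) auto
    then have "\<theta> T d \<le> (\<lambda>(\<sigma>, t). d t $ \<sigma>) (c, t)"
      unfolding \<theta>_def by (rule cINF_lower) (use t in auto)
    then show ?thesis by simp
  qed
  have g0: "\<gamma>\<^sub>0 T d > 0" using assms(9) by (simp add: \<gamma>\<^sub>0_def divide_neg_neg)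
  have th: "\<theta> T d = - 1 / \<gamma>\<^sub>0 T d" using assms(9) by (simp add: \<gamma>\<^sub>0_def)

  \<comment> \<open>As \<open>d\<close> is zero in the active mode \<open>b\<close>, the infimum is attained where \<open>d\<^sub>c - d\<^sub>b = \<theta>\<close>.\<close>
  have neg: "negligible {t \<in> {0..T}. \<exists>c. d t $ c = \<theta> T d}"
  proof (rule negligible_subset)
    let ?L = "\<Union>i. \<Union>j\<in>- {i}. {t \<in> {0..T}. d t $ i - d t $ j = \<theta> T d}"
    show "negligible ?L" by (intro negligible_finite finite_UN_I lev) auto
    show "{t \<in> {0..T}. \<exists>c. d t $ c = \<theta> T d} \<subseteq> ?L"
    proof
      fix t assume "t \<in> {t \<in> {0..T}. \<exists>c. d t $ c = \<theta> T d}"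
      then obtain c where t: "t \<in> {0..T}" and c: "d t $ c = \<theta> T d" by blast
      obtain b where b: "d t $ b = 0" using Omega_axis[OF u t] act by blast
      then have "c \<noteq> b" using c assms(9) by auto
      then have "t \<in> (\<Union>j\<in>- {c}. {t \<in> {0..T}. d t $ c - d t $ j = \<theta> T d})"
        using t b c by (intro UN_I[of b]) simp_all
      then show "t \<in> ?L" by (rule UN_I[OF UNIV_I])
    qed
  qed
  have int: "?I \<gamma> integrable_on {0..T}" if "\<gamma> > 0" for \<gamma>
    using proj[OF that] first_order(1)[OF that] by blast
  have pos: "0 < integral {0..T} (?I \<gamma>)" if g: "\<gamma> > \<gamma>\<^sub>0 T d" for \<gamma>
  proof -
    have gp: "\<gamma> > 0" using g g0 by linarith
    have "\<theta> T d < - 1 / \<gamma>" unfolding th using g g0 gp by (simp add: field_simps)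
    have "\<exists>\<sigma> t. t \<in> {0..T} \<and> d t $ \<sigma> < - 1 / \<gamma>"
    proof (rule ccontr)
      assume "\<nexists>\<sigma> t. t \<in> {0..T} \<and> d t $ \<sigma> < - 1 / \<gamma>"
      then have "- 1 / \<gamma> \<le> \<theta> T d"
        unfolding \<theta>_def using T by (intro cINF_greatest) (auto simp: not_less)
      then show False using \<open>\<theta> T d < - 1 / \<gamma>\<close> by simp
    qed
    then obtain \<sigma> t where t: "t \<in> {0..T}" "H \<sigma> t (u t) < - 1 / \<gamma>" unfolding d by blast
    obtain b where b: "u t = axis b 1" using Omega_axis[OF u t(1)] by blast
    have "continuous_on {0..T} (\<lambda>s. H \<sigma> s (u t))" unfolding b by (rule cH)
    from strict_inequality_persists[OF u t(1), where H = "H \<sigma>", OF this t(2)]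
    obtain p q where pq: "p < q" "{p..q} \<subseteq> {0..T}" "\<forall>s\<in>{p..q}. d s $ \<sigma> < - 1 / \<gamma>"
      unfolding d by blast
    have one: "?I \<gamma> s = 1" if "s \<in> {p..q}" for s using pq(3) that by auto
    have "0 < q - p" using pq by simp
    also have "q - p = integral {p..q} (\<lambda>_. 1 :: real)" using pq by simp
    also have "\<dots> = integral {p..q} (?I \<gamma>)" by (rule integral_cong) (simp only: one)
    also have "\<dots> \<le> integral {0..T} (?I \<gamma>)"
      by (rule integral_subset_le[OF pq(2) integrable_subinterval_real[OF int[OF gp] pq(2)] int[OF gp]]) simp
    finally show ?thesis .
  qed

  obtain \<eta> A where \<eta>: "\<eta> > 0" and A: "A \<ge> 0" and near: "\<forall>v\<in>\<Omega> T. mismatch T u v < \<eta> \<longrightarrow>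
    (\<exists>y. trajectory f x0 T y v \<and> (\<forall>t\<in>{0..T}. norm (y t - x t) \<le> A * mismatch T u v))"
    using nearby_trajectory[OF T f u x] by blast
  obtain M where M: "M \<ge> 0" and expan: "\<forall>v\<in>\<Omega> T. \<forall>y r. trajectory f x0 T y v \<and> (\<forall>t\<in>{0..T}. norm (y t - x t) \<le> r) \<longrightarrow>
    \<bar>integral {0..T} (\<lambda>t. l (y t)) - integral {0..T} (\<lambda>t. l (x t)) - integral {0..T} (?F v)\<bar>
    \<le> M * (r\<^sup>2 + r * mismatch T u v)"
    using cost_expansion[OF T f l u x assms(5)] by blast
  define M' where "M' = M * (A\<^sup>2 + A)"
  have M': "M' \<ge> 0" using M A by (simp add: M'_def)
  \<comment> \<open>The second bound gives \<open>M' \<epsilon> < 1 / (\<gamma>\<^sub>0 + 1) < 1 / \<gamma>\<close> for \<open>\<gamma> < \<gamma>\<^sub>0 + 1\<close>, so that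
    \<open>M' \<epsilon>\<^sup>2\<close> cannot cancel the gain \<open>\<epsilon> / \<gamma>\<close>.\<close>
  define e where "e = min \<eta> (1 / ((M' + 1) * (\<gamma>\<^sub>0 T d + 1)))"
  have "e > 0" using \<eta> M' g0 by (simp add: e_def)
  from sublevel_indicator_vanishes[OF assms(9) low neg int this]
  obtain \<delta> where \<delta>: "\<delta> > 0"
    and small: "\<forall>\<gamma>\<in>{\<gamma>\<^sub>0 T d <..< \<gamma>\<^sub>0 T d + \<delta>}. integral {0..T} (?I \<gamma>) < e"
    unfolding \<gamma>\<^sub>0_def by blast

  have unchanged: "J l T (\<P> f x0 T x (line u d 0)) = integral {0..T} (\<lambda>t. l (x t))"
  proof -
    have "\<Q> (line u d 0) t = u t" if "t \<in> {0..T}" for t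
      using Omega_axis[OF u that] Q_unit_vector[of "line u d 0" t] by (auto simp: line_def)
    then have "ae_eq T u (\<Q> (line u d 0))" unfolding ae_eq_def by simp
    then obtain y v where yv: "\<P> f x0 T x (line u d 0) = (y, v)" "(y, v) \<in> \<S> f x0 T"
      and "ae_eq T v (\<Q> (line u d 0))"
      using P_spec[OF assms(4), where \<alpha> = x and \<mu> = "line u d 0"] by blast
    then have 0: "mismatch T u v = 0"
      using \<open>ae_eq T u (\<Q> (line u d 0))\<close> by (intro mismatch_ae_eq) (blast intro: ae_eq_trans ae_eq_sym)
    have v: "v \<in> \<Omega> T" "trajectory f x0 T y v" using yv(2) S_iff[OF T] by blast+
    have "y t = x t" if "t \<in> {0..T}" for t
      by (rule trajectory_unique[OF T f u v(1) 0 x v(2) that])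
    then show ?thesis unfolding J_def yv(1) by (intro integral_cong) simp
  qed

  have descent: "J l T (\<P> f x0 T x (line u d \<gamma>)) < integral {0..T} (\<lambda>t. l (x t))"
    if g: "\<gamma> \<in> {\<gamma>\<^sub>0 T d <..< \<gamma>\<^sub>0 T d + min \<delta> 1}" for \<gamma>
  proof -
    have gp: "\<gamma> > 0" "\<gamma> > \<gamma>\<^sub>0 T d" "\<gamma> < \<gamma>\<^sub>0 T d + 1" using g g0 by auto
    let ?\<epsilon> = "integral {0..T} (?I \<gamma>)"
    have e: "0 < ?\<epsilon>" "?\<epsilon> < e" using pos[OF gp(2)] small g by auto
    have \<epsilon>\<eta>: "?\<epsilon> < \<eta>" using e unfolding e_def by simp
    \<comment> \<open>\<open>v0\<close> only shows that the choice in \<open>\<P>\<close> succeeds; the estimates are then applied to the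
      chosen pair itself.\<close>
    obtain v0 where v0: "v0 \<in> \<Omega> T" "ae_eq T v0 (\<Q> (line u d \<gamma>))" using proj[OF gp(1)] by blast
    have "mismatch T u v0 < \<eta>" using first_order(2)[OF gp(1) v0] \<epsilon>\<eta> by simp
    then obtain y0 where "trajectory f x0 T y0 v0" using near v0(1) by blast
    then have "(y0, v0) \<in> \<S> f x0 T" using S_iff[OF T] v0(1) by blast
    then obtain y v where yv: "\<P> f x0 T x (line u d \<gamma>) = (y, v)" "(y, v) \<in> \<S> f x0 T"
      and ae: "ae_eq T v (\<Q> (line u d \<gamma>))"
      using P_spec[OF _ v0(2), where \<alpha> = x] by blast
    have v: "v \<in> \<Omega> T" and y: "trajectory f x0 T y v" using yv(2) S_iff[OF T] by blast+
    have mm: "mismatch T u v = ?\<epsilon>" by (rule first_order(2)[OF gp(1) v ae])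
    then obtain y' where y': "trajectory f x0 T y' v" "\<forall>t\<in>{0..T}. norm (y' t - x t) \<le> A * ?\<epsilon>"
      using near v \<epsilon>\<eta> by auto
    have "mismatch T v v = 0" by (simp add: mismatch_def)
    then have "y t = y' t" if "t \<in> {0..T}" for t
      using trajectory_unique[OF T f v v _ y'(1) y that] by blast
    then have close: "\<forall>t\<in>{0..T}. norm (y t - x t) \<le> A * ?\<epsilon>" using y'(2) by simp
    have "\<bar>integral {0..T} (\<lambda>t. l (y t)) - integral {0..T} (\<lambda>t. l (x t)) - integral {0..T} (?F v)\<bar>
      \<le> M * ((A * ?\<epsilon>)\<^sup>2 + A * ?\<epsilon> * ?\<epsilon>)"
      using expan v y close unfolding mm[symmetric] by blast
    also have "\<dots> = M' * ?\<epsilon> * ?\<epsilon>" by (simp add: M'_def power2_eq_square algebra_simps)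
    finally have "integral {0..T} (\<lambda>t. l (y t)) \<le>
      integral {0..T} (\<lambda>t. l (x t)) + integral {0..T} (?F v) + M' * ?\<epsilon> * ?\<epsilon>" by linarith
    also have "\<dots> \<le> integral {0..T} (\<lambda>t. l (x t)) + (- 1 / \<gamma> * ?\<epsilon>) + M' * ?\<epsilon> * ?\<epsilon>"
      using first_order(3)[OF gp(1) v ae] unfolding mm by simp
    also have "\<dots> = integral {0..T} (\<lambda>t. l (x t)) - ?\<epsilon> * (1 / \<gamma> - M' * ?\<epsilon>)"
      by (simp add: algebra_simps)
    also have "\<dots> < integral {0..T} (\<lambda>t. l (x t))"
    proof -
      have "M' * ?\<epsilon> \<le> (M' + 1) * ?\<epsilon>" using e(1) by (simp add: algebra_simps)
      also have "\<dots> < (M' + 1) * (1 / ((M' + 1) * (\<gamma>\<^sub>0 T d + 1)))"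
        using e(2) M' unfolding e_def by (intro mult_strict_left_mono) auto
      also have "\<dots> = 1 / (\<gamma>\<^sub>0 T d + 1)" using M' by simp
      also have "\<dots> < 1 / \<gamma>" using gp g0 by (simp add: frac_less2)
      finally show ?thesis using e(1) by simp
    qed
    finally show ?thesis unfolding J_def yv(1) by simp
  qed
  show ?thesis unfolding unchanged
    by (rule exI[of _ "min \<delta> 1"]) (use \<delta> descent in auto)
qed

end
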